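(* Let $x_1,x_2,x_3,x_4\in\mathbb R^3$ be the vertices of an edge-tangential tetrahedron, i.e. a tetrahedron for which there is a sphere touching all six edges (equivalently for the purposes here, $r_{ij}=t_i+t_j$ for $1\le i<j\le 4$, where $t_i>0$ is the length of the tangent segment from $x_i$ to the sphere). Then: (C3) $|D_4|^2\ge \prod_{\{i<j<k\}\subset\{1,2,3,4\}}\bigl(d_3(r_{ij},r_{ik},r_{jk})+8r_{ij}r_{ik}r_{jk}\bigr)$; (Strong Four Points inequality) $$\Re(D_4)-\Bigl(4+\tfrac34\Bigr)\cdot 288V^2\ \ge\ 64\prod_{1\le i<j\le 4}r_{ij}+\sum_{l=1}^4\Bigl(4+\tfrac14\Bigr)r_{il}r_{jl}r_{kl}\,d_3(r_{ij},r_{ik},r_{jk}),$$ where for each $l$ one writes $\{1,2,3,4\}\setminus\{l\}=\{i<j<k\}$.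
   Context: Put $d_3(a,b,c)=(a+b-c)(b+c-a)(c+a-b)$. For distinct points $x_1,\dots,x_4\in\mathbb R^3$ let $r_{ij}=|x_i-x_j|$, and let $V$ be the volume of the tetrahedron with these vertices ($V=0$ if coplanar). The (non-normalized) Atiyah determinant $D_4\in\mathbb C$ is defined as follows. Identify $S^2$ with $\mathbb{CP}^1=\mathbb C\cup\{\infty\}$ by stereographic projection, so that the antipode of $t$ is $-1/\bar t$. For $i\ne j$ let $t_{ij}$ be the point corresponding to the unit vector $(x_j-x_i)/r_{ij}$. For each pair $i<j$ choose a unit vector $(\alpha,\beta)\in\mathbb C^2$ such that $\ell_{ij}(t)=\alpha t+\beta$ has root $t_{ij}$ (with $\alpha=0$ if $t_{ij}=\infty$), and put $\ell_{ji}(t)=-\bar\beta t+\bar\alpha$ (which has root $t_{ji}$). Let $p_i(t)=\prod_{j\ne i}\ell_{ij}(t)=\sum_{j=1}^4 m_{ij}t^{j-1}$ and $D_4=64\prod_{1\le i<j\le4}r_{ij}\cdot\det(m_{ij})$; this does not depend on the choices. Known fact (Eastwood–Norbury): $$\Re(D_4)=64\prod_{i<j}r_{ij}-4d_3(r_{12}r_{34},r_{13}r_{24},r_{14}r_{23})+A_4+288V^2,$$ $$A_4=\sum_{l=1}^4\Bigl(\sum_{i\ne l}r_{li}\bigl((r_{lj}+r_{lk})^2-r_{jk}^2\bigr)\Bigr)d_3(r_{ij},r_{ik},r_{jk}),\qquad \{j,k\}=\{1,2,3,4\}\setminus\{l,i\}.$$ *)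

theory Defs
  imports "HOL-Analysis.Analysis" "Jordan_Normal_Form.Determinant"
begin

(* Both libraries use the infix "$"; keep it for the components of vectors in real^3. *)
no_notation Matrix.vec_index (infixl "$" 100)

definition d3 :: "real \<Rightarrow> real \<Rightarrow> real \<Rightarrow> real" where
  "d3 a b c = (a + b - c) * (b + c - a) * (c + a - b)"

text \<open>A configuration is a map \<open>x\<close> of which only the values at the indices 1, 2, 3, 4 matter.\<close>

definition edge_len :: "(nat \<Rightarrow> real^3) \<Rightarrow> nat \<Rightarrow> nat \<Rightarrow> real" where
  "edge_len x i j = dist (x i) (x j)"

definition tetra_volume :: "(nat \<Rightarrow> real^3) \<Rightarrow> real" where
  "tetra_volume x = measure lebesgue (convex hull (x ` {1..4}))"

text \<open>A sphere touches an edge if the line through the edge meets the sphere in exactly one point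
  and this point of tangency lies on the edge.\<close>

definition touches_edge :: "real^3 \<Rightarrow> real \<Rightarrow> real^3 \<Rightarrow> real^3 \<Rightarrow> bool" where
  "touches_edge c \<rho> a b \<longleftrightarrow> (\<exists>p \<in> closed_segment a b. affine hull {a, b} \<inter> sphere c \<rho> = {p})"

text \<open>For pairwise distinct vertices this forces the tetrahedron to be non-degenerate and the points
  of tangency to be interior to the edges.\<close>

definition edge_tangential :: "(nat \<Rightarrow> real^3) \<Rightarrow> bool" where
  "edge_tangential x \<longleftrightarrow>
     (\<exists>c \<rho>. \<rho> > 0 \<and> (\<forall>i\<in>{1..4}. \<forall>j\<in>{1..4}. i < j \<longrightarrow> touches_edge c \<rho> (x i) (x j)))"

text \<open>Stereographic projection of a unit vector from the north pole \<open>(0, 0, 1)\<close>; the point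
  \<open>\<infinity>\<close> of the Riemann sphere is represented by \<open>None\<close>.\<close>

definition stereo :: "real^3 \<Rightarrow> complex option" where
  "stereo u = (if u $ 3 = 1 then None
               else Some (Complex (u $ 1 / (1 - u $ 3)) (u $ 2 / (1 - u $ 3))))"

definition atiyah_root :: "(nat \<Rightarrow> real^3) \<Rightarrow> nat \<Rightarrow> nat \<Rightarrow> complex option" where
  "atiyah_root x i j = stereo ((x j - x i) /\<^sub>R edge_len x i j)"

text \<open>The linear forms \<open>\<alpha>\<^sub>i\<^sub>j t + \<beta>\<^sub>i\<^sub>j\<close>, \<open>i < j\<close>, are only determined up to phases. The predicate
  describes the allowed choices, and the determinant below takes the choice as a parameter.\<close>

definition admissible_choice ::
  "(nat \<Rightarrow> real^3) \<Rightarrow> (nat \<Rightarrow> nat \<Rightarrow> complex) \<Rightarrow> (nat \<Rightarrow> nat \<Rightarrow> complex) \<Rightarrow> bool" where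
  "admissible_choice x \<alpha> \<beta> \<longleftrightarrow>
     (\<forall>i\<in>{1..4}. \<forall>j\<in>{1..4}. i < j \<longrightarrow>
        (cmod (\<alpha> i j))\<^sup>2 + (cmod (\<beta> i j))\<^sup>2 = 1 \<and>
        (case atiyah_root x i j of
           None \<Rightarrow> \<alpha> i j = 0
         | Some t \<Rightarrow> \<alpha> i j * t + \<beta> i j = 0))"

definition atiyah_ell ::
  "(nat \<Rightarrow> nat \<Rightarrow> complex) \<Rightarrow> (nat \<Rightarrow> nat \<Rightarrow> complex) \<Rightarrow> nat \<Rightarrow> nat \<Rightarrow> complex poly" where
  "atiyah_ell \<alpha> \<beta> i j =
     (if i < j then [:\<beta> i j, \<alpha> i j:] else [:cnj (\<alpha> j i), - cnj (\<beta> j i):])"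

definition atiyah_poly ::
  "(nat \<Rightarrow> nat \<Rightarrow> complex) \<Rightarrow> (nat \<Rightarrow> nat \<Rightarrow> complex) \<Rightarrow> nat \<Rightarrow> complex poly" where
  "atiyah_poly \<alpha> \<beta> i = (\<Prod>j \<in> {1..4} - {i}. atiyah_ell \<alpha> \<beta> i j)"

text \<open>Matrix positions count from 0: entry \<open>(i, j)\<close> is the coefficient of \<open>t\<^sup>j\<close> in the
  polynomial belonging to the vertex \<open>i + 1\<close>.\<close>

definition atiyah_D4 ::
  "(nat \<Rightarrow> real^3) \<Rightarrow> (nat \<Rightarrow> nat \<Rightarrow> complex) \<Rightarrow> (nat \<Rightarrow> nat \<Rightarrow> complex) \<Rightarrow> complex" where
  "atiyah_D4 x \<alpha> \<beta> =
     64 * (\<Prod>(i, j) \<in> {(i, j). 1 \<le> i \<and> i < j \<and> j \<le> 4}. complex_of_real (edge_len x i j)) *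
     Determinant.det (mat 4 4 (\<lambda>(i, j). coeff (atiyah_poly \<alpha> \<beta> (i + 1)) j))"

end

theory Submission
  imports Defs
begin

text \<open>Tangency gives \<open>r\<^sub>i\<^sub>j = t\<^sub>i + t\<^sub>j\<close>, so everything reduces to polynomials in four nonnegative reals, once
  the Atiyah determinant is known to be such a polynomial.

  The determinant of four binary cubics is the Pfaffian of their values under the \<open>SL(2)\<close>-invariant
  symplectic form, so it does not change when all spinors are rotated by a common element of \<open>SU(2)\<close>.
  Rotating \<open>x\<^sub>2 - x\<^sub>1\<close> to the third axis makes \<open>\<ell>\<^sub>1\<^sub>2\<close> constant, and the determinant becomes a polynomial
  with 64 terms in the entries of the Hermitian matrices \<open>r\<^sub>i\<^sub>j + \<sigma> \<cdot> (x\<^sub>j - x\<^sub>i)\<close>. Up to a common factor their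
  diagonal entries are quadratic forms in the \<open>t\<^sub>i\<close>, and the off-diagonal ones depend linearly on
  the edge vectors, so that only two complex unknowns \<open>z, y\<close> remain, which enter only through
  \<open>|z|\<^sup>2\<close>, \<open>|y|\<^sup>2\<close> and \<open>|y - z|\<^sup>2\<close>. In particular \<open>D\<^sub>4\<close> is real.

  The strong four points inequality is then a sum of squares with nonnegative coefficients. For (C3),
  put \<open>\<delta>\<^sub>i\<^sub>j\<^sub>k = d\<^sub>3 / (r\<^sub>i\<^sub>j r\<^sub>i\<^sub>k r\<^sub>j\<^sub>k) \<in> [0, 1]\<close>: the strong four points inequality yields
  \<open>D\<^sub>4 \<ge> (64 + 17/4 \<Sum> \<delta>) \<Prod> r\<close>, and \<open>\<Prod> (8 + \<delta>) \<le> (64 + 17/4 \<Sum> \<delta>)\<^sup>2\<close> by AM-GM.\<close>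

section \<open>Edge lengths and volume\<close>

text \<open>Mirroring \<open>q\<close> in the foot of the perpendicular from \<open>c\<close> to the
  line gives a point \<open>q'\<close> of the line at the same distance from \<open>c\<close>. The
  sphere meets the line only once, so \<open>q' = q\<close>, that is, \<open>q\<close> is the foot
  itself. The step \<open>s\<close> is twice the way from \<open>q\<close> to the foot.\<close>

lemma tangent_foot_orthogonal:
  fixes a b c q :: "'a :: real_inner"
  assumes "affine hull {a, b} \<inter> sphere c \<rho> = {q}"
  shows "inner (b - a) (q - c) = 0"
proof (cases "a = b")
  case False
  define s where "s = - 2 * inner (b - a) (q - c) / inner (b - a) (b - a)"
  define q' where "q' = q + s *\<^sub>R (b - a)"
  from False have ne: "inner (b - a) (b - a) \<noteq> 0" by simp
  have q: "q \<in> affine hull {a, b}" "dist c q = \<rho>" using assms by auto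
  from q(1) obtain u v where uv: "q = u *\<^sub>R a + v *\<^sub>R b" "u + v = 1"
    by (auto simp: affine_hull_2)
  have "q' = (u - s) *\<^sub>R a + (v + s) *\<^sub>R b" by (simp add: q'_def uv algebra_simps)
  with uv(2) have 1: "q' \<in> affine hull {a, b}" by (force simp: affine_hull_2)
  have "inner (q' - c) (q' - c)
      = inner (q - c) (q - c) + s * (2 * inner (b - a) (q - c) + s * inner (b - a) (b - a))"
    by (simp add: q'_def algebra_simps inner_commute)
  also have "2 * inner (b - a) (q - c) + s * inner (b - a) (b - a) = 0"
    using ne by (simp add: s_def)
  finally have "norm (q' - c) = norm (q - c)"
    by (simp add: norm_eq_sqrt_inner)
  then have "dist c q' = dist c q" by (metis dist_commute dist_norm)
  with 1 q(2) have "q' \<in> affine hull {a, b} \<inter> sphere c \<rho>" by simp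
  then have "q' = q" unfolding assms by simp
  with False have "s = 0" by (simp add: q'_def)
  with ne show ?thesis by (simp add: s_def)
qed simp

text \<open>Pythagoras at the tangent point: the tangent segment from an endpoint depends only on
  its distance to \<open>c\<close> and on \<open>\<rho>\<close>, and the two segments add up because
  the tangent point lies on the edge. Since \<open>sqrt\<close> is an odd function on the reals,
  nonnegativity of the two roots has content; it holds because they are distances.\<close>

lemma touches_edge_dist:
  assumes "touches_edge c \<rho> a b"
  shows "dist a b = sqrt ((dist a c)\<^sup>2 - \<rho>\<^sup>2) + sqrt ((dist b c)\<^sup>2 - \<rho>\<^sup>2)"
    and "sqrt ((dist a c)\<^sup>2 - \<rho>\<^sup>2) \<ge> 0" and "sqrt ((dist b c)\<^sup>2 - \<rho>\<^sup>2) \<ge> 0"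
proof -
  from assms obtain q where q: "q \<in> closed_segment a b" "affine hull {a, b} \<inter> sphere c \<rho> = {q}"
    by (auto simp: touches_edge_def)
  from q(1) obtain u where u: "q = (1 - u) *\<^sub>R a + u *\<^sub>R b" by (auto simp: closed_segment_def)
  have orth: "inner (b - a) (q - c) = 0" by (rule tangent_foot_orthogonal[OF q(2)])
  have "dist c q = \<rho>" using q(2) by auto
  then have rho: "inner (q - c) (q - c) = \<rho>\<^sup>2"
    by (metis dist_norm norm_minus_commute power2_norm_eq_inner)
  have pyth: "(dist (q + s *\<^sub>R (b - a)) c)\<^sup>2 = \<rho>\<^sup>2 + (norm (s *\<^sub>R (b - a)))\<^sup>2" for s
  proof -
    have "(dist (q + s *\<^sub>R (b - a)) c)\<^sup>2
        = inner (q - c) (q - c) + 2 * s * inner (b - a) (q - c) + inner (s *\<^sub>R (b - a)) (s *\<^sub>R (b - a))"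
      by (simp add: dist_norm power2_norm_eq_inner algebra_simps inner_commute)
    then show ?thesis unfolding power2_norm_eq_inner orth rho by simp
  qed
  \<comment> \<open>With \<open>q\<close> as origin of the line, both endpoints become instances of
    \<open>pyth\<close>.\<close>
  have a: "a = q + (- u) *\<^sub>R (b - a)" and b: "b = q + (1 - u) *\<^sub>R (b - a)"
    by (simp_all add: u algebra_simps)
  have tangent: "dist (q + s *\<^sub>R (b - a)) q = sqrt ((dist (q + s *\<^sub>R (b - a)) c)\<^sup>2 - \<rho>\<^sup>2)" for s
    unfolding pyth by (simp add: dist_norm)
  note 1 = tangent[of "- u", folded a] and 2 = tangent[of "1 - u", folded b]
  have "dist a b = dist a q + dist q b" using q(1) by (simp add: between_mem_segment[symmetric] between)
  then have "dist a b = dist a q + dist b q" by (metis dist_commute)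
  then show "dist a b = sqrt ((dist a c)\<^sup>2 - \<rho>\<^sup>2) + sqrt ((dist b c)\<^sup>2 - \<rho>\<^sup>2)"
    unfolding 1 2 .
  show "sqrt ((dist a c)\<^sup>2 - \<rho>\<^sup>2) \<ge> 0" "sqrt ((dist b c)\<^sup>2 - \<rho>\<^sup>2) \<ge> 0"
    unfolding 1[symmetric] 2[symmetric] by simp_all
qed

text \<open>The tangent length of a vertex is the same for all edges through it, since its formula
  involves only that vertex and the sphere.\<close>

lemma edge_tangential_lengths:
  assumes "edge_tangential x"
  obtains t :: "nat \<Rightarrow> real" where "\<And>i. i \<in> {1..4} \<Longrightarrow> t i \<ge> 0"
    "\<And>i j. i \<in> {1..4} \<Longrightarrow> j \<in> {1..4} \<Longrightarrow> i < j \<Longrightarrow> edge_len x i j = t i + t j"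
proof -
  from assms obtain c \<rho> where c: "\<rho> > 0"
    "\<And>i j. i \<in> {1..4} \<Longrightarrow> j \<in> {1..4} \<Longrightarrow> i < j \<Longrightarrow> touches_edge c \<rho> (x i) (x j)"
    unfolding edge_tangential_def by blast
  define t where "t i = sqrt ((dist (x i) c)\<^sup>2 - \<rho>\<^sup>2)" for i
  show thesis
  proof (rule that)
    show "edge_len x i j = t i + t j" if "i \<in> {1..4}" "j \<in> {1..4}" "i < j" for i j
      using touches_edge_dist(1)[OF c(2)[OF that]] by (simp add: edge_len_def t_def)
    \<comment> \<open>Edges are given for increasing indices only: for \<open>i < 4\<close> the edge
      from \<open>i\<close> to 4 is used, for \<open>i = 4\<close> the edge from 1 to 4.\<close>
    show "t i \<ge> 0" if "i \<in> {1..4}" for i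
      using touches_edge_dist(2,3)[OF c(2), of i 4] touches_edge_dist(2,3)[OF c(2), of 1 i] that
      by (cases "i < 4") (auto simp: t_def) (*X*)
  qed
qed

section \<open>The squared volume as a Gram determinant\<close>

text \<open>With columns \<open>a\<close>, \<open>b\<close>, \<open>c\<close>, the square of det M
  is the determinant of M^T M, whose entries are the inner products.\<close>

lemma gram_3:
  fixes a b c :: "real^3"
  defines "M \<equiv> (\<chi> i. \<chi> j. (if j = 1 then a else if j = 2 then b else c) $ i)"
  shows "(Determinants.det M)\<^sup>2 = inner a a * inner b b * inner c c + 2 * inner a b * inner b c * inner a c
     - inner a a * (inner b c)\<^sup>2 - inner b b * (inner a c)\<^sup>2 - inner c c * (inner a b)\<^sup>2"
proof -
  have det: "Determinants.det M = a $ 1 * b $ 2 * c $ 3 + b $ 1 * c $ 2 * a $ 3 + c $ 1 * a $ 2 * b $ 3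
      - a $ 1 * c $ 2 * b $ 3 - b $ 1 * a $ 2 * c $ 3 - c $ 1 * b $ 2 * a $ 3"
    by (simp add: M_def Determinants.det_3)
  have inner: "inner u v = u $ 1 * v $ 1 + u $ 2 * v $ 2 + u $ 3 * v $ 3" for u v :: "real^3"
    by (simp add: inner_vec_def sum_3)
  show ?thesis
    unfolding det inner by (simp add: algebra_simps power2_eq_square)
qed

lemma tetra_volume_gram:
  assumes "inj_on x {1..4}"
  defines "a \<equiv> x 2 - x 1" and "b \<equiv> x 3 - x 1" and "c \<equiv> x 4 - x 1"
  shows "36 * (tetra_volume x)\<^sup>2 = inner a a * inner b b * inner c c + 2 * inner a b * inner b c * inner a c
     - inner a a * (inner b c)\<^sup>2 - inner b b * (inner a c)\<^sup>2 - inner c c * (inner a b)\<^sup>2"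
proof -
  define M :: "real^3^3" where "M = (\<chi> i. \<chi> j. (if j = 1 then a else if j = 2 then b else c) $ i)"
  define f :: "3 \<Rightarrow> real^3" where "f j = (if j = 1 then x 2 else if j = 2 then x 3 else x 4)" for j
  let ?X = "x ` {1..4::nat}"
  have 14: "{1..4::nat} = {1, 2, 3, 4}" by auto
  have ne: "x i \<noteq> x j" if "i \<in> {1..4}" "j \<in> {1..4}" "i \<noteq> j" for i j
    using assms(1) that by (auto simp: inj_on_def)
  note ne' = ne[of 1 2] ne[of 1 3] ne[of 1 4] ne[of 2 3] ne[of 2 4] ne[of 3 4]
  have card: "card ?X = Suc CARD(3)" using assms(1) by (simp add: card_image)
  have inj: "inj f"
  proof (rule injI)
    fix i j :: 3
    assume "f i = f j"
    then show "i = j"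
      using exhaust_3[of i] exhaust_3[of j] ne' by (auto simp: f_def)
  qed
  have "range f = ?X - {x 1}" unfolding UNIV_3 14 using ne' by (auto simp: f_def)
  with inj have bij: "bij_betw f UNIV (?X - {x 1})" by (simp add: bij_betw_def)
  have M: "M = (\<chi> i. \<chi> j. f j $ i - x 1 $ i)"
  proof -
    have "(if j = 1 then a else if j = 2 then b else c) $ i = f j $ i - x 1 $ i" for i j :: 3
      by (auto simp: f_def a_def b_def c_def)
    then show ?thesis by (simp only: M_def)
  qed
  \<comment> \<open>A compact set is Borel, so its Lebesgue measure is the \<open>lborel\<close>
    content computed by \<open>content_simplex\<close>.\<close>
  have "compact (convex hull ?X)" by (intro finite_imp_compact_convex_hull) auto
  then have "tetra_volume x = measure lborel (convex hull ?X)"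
    unfolding tetra_volume_def by (intro measure_completion) (auto dest: compact_imp_closed)
  also have "\<dots> = \<bar>Determinants.det M\<bar> / fact CARD(3)"
    using content_simplex[OF _ card _ bij] unfolding M by simp
  finally have vol: "tetra_volume x = \<bar>Determinants.det M\<bar> / 6"
    by (simp add: fact_numeral)
  have "36 * (tetra_volume x)\<^sup>2 = (Determinants.det M)\<^sup>2"
    unfolding vol by (simp add: power_divide)
  then show ?thesis unfolding M_def by (rule trans[OF _ gram_3])
qed

section \<open>Determinants of binary cubics\<close>

text \<open>Laplace expansion along the first row. The minors are again matrices given by an index
  function, so rewriting can repeat the expansion until a polynomial is left.\<close>

lemma det_mat_Suc:
  fixes f :: "nat \<Rightarrow> nat \<Rightarrow> 'a :: comm_ring_1"
  shows "Determinant.det (mat (Suc n) (Suc n) (\<lambda>(i, j). f i j)) =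
    (\<Sum>k<Suc n. (-1) ^ k * f 0 k *
      Determinant.det (mat n n (\<lambda>(i, j). f (Suc i) (if j < k then j else Suc j))))"
proof -
  let ?A = "mat (Suc n) (Suc n) (\<lambda>(i, j). f i j)"
  have "Determinant.det ?A = (\<Sum>k<Suc n. ?A $$ (0, k) * cofactor ?A 0 k)"
    by (rule laplace_expansion_row) auto
  also have "mat_delete ?A 0 k = mat n n (\<lambda>(i, j). f (Suc i) (if j < k then j else Suc j))"
    if "k < Suc n" for k
    using that by (auto simp: mat_delete_def intro!: eq_matI)
  then have "(\<Sum>k<Suc n. ?A $$ (0, k) * cofactor ?A 0 k) = (\<Sum>k<Suc n. (-1) ^ k * f 0 k *
      Determinant.det (mat n n (\<lambda>(i, j). f (Suc i) (if j < k then j else Suc j))))"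
    by (intro sum.cong) (auto simp: cofactor_def)
  finally show ?thesis .
qed

lemma det_mat_4:
  fixes m :: "nat \<Rightarrow> nat \<Rightarrow> 'a :: comm_ring_1"
  shows "Determinant.det (mat 4 4 (\<lambda>(i, j). m i j)) =
   m 0 0 * (m 1 1 * (m 2 2 * m 3 3 - m 2 3 * m 3 2) - m 1 2 * (m 2 1 * m 3 3 - m 2 3 * m 3 1) + m 1 3 * (m 2 1 * m 3 2 - m 2 2 * m 3 1))
 - m 0 1 * (m 1 0 * (m 2 2 * m 3 3 - m 2 3 * m 3 2) - m 1 2 * (m 2 0 * m 3 3 - m 2 3 * m 3 0) + m 1 3 * (m 2 0 * m 3 2 - m 2 2 * m 3 0))
 + m 0 2 * (m 1 0 * (m 2 1 * m 3 3 - m 2 3 * m 3 1) - m 1 1 * (m 2 0 * m 3 3 - m 2 3 * m 3 0) + m 1 3 * (m 2 0 * m 3 1 - m 2 1 * m 3 0))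
 - m 0 3 * (m 1 0 * (m 2 1 * m 3 2 - m 2 2 * m 3 1) - m 1 1 * (m 2 0 * m 3 2 - m 2 2 * m 3 0) + m 1 2 * (m 2 0 * m 3 1 - m 2 1 * m 3 0))"
  by (simp add: numeral_eq_Suc det_mat_Suc algebra_simps)

text \<open>Three times the \<open>SL(2)\<close>-invariant symplectic form on binary cubics.\<close>

definition cubic_pairing :: "(nat \<Rightarrow> complex) \<Rightarrow> (nat \<Rightarrow> complex) \<Rightarrow> complex" where
  "cubic_pairing f g = 3 * f 0 * g 3 - f 1 * g 2 + f 2 * g 1 - 3 * f 3 * g 0"

text \<open>The pairings of the rows form the matrix M J M^T with J the matrix of
  \<open>cubic_pairing\<close>, and Pf(M J M^T) = det(M) Pf(J). Here Pf(J) = -3.\<close>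

lemma det_eq_pfaffian:
  "3 * Determinant.det (mat 4 4 (\<lambda>(i, j). m i j)) =
     - (cubic_pairing (m 0) (m 1) * cubic_pairing (m 2) (m 3)
     - cubic_pairing (m 0) (m 2) * cubic_pairing (m 1) (m 3)
     + cubic_pairing (m 0) (m 3) * cubic_pairing (m 1) (m 2))"
  unfolding det_mat_4 cubic_pairing_def by (simp add: algebra_simps)

definition cubic :: "(nat \<Rightarrow> complex) \<Rightarrow> (nat \<Rightarrow> complex) \<Rightarrow> complex poly" where
  "cubic a b = [:b 0, a 0:] * [:b 1, a 1:] * [:b 2, a 2:]"

lemma coeff_cubic:
  "coeff (cubic a b) 0 = b 0 * b 1 * b 2"
  "coeff (cubic a b) 1 = a 0 * b 1 * b 2 + b 0 * a 1 * b 2 + b 0 * b 1 * a 2"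
  "coeff (cubic a b) 2 = a 0 * a 1 * b 2 + a 0 * b 1 * a 2 + b 0 * a 1 * a 2"
  "coeff (cubic a b) 3 = a 0 * a 1 * a 2"
  by (simp_all add: cubic_def numeral_eq_Suc algebra_simps)

text \<open>The right side is the permanent of the brackets \<open>br i j\<close>, the 2 by 2
  determinants of pairs of linear factors. In this form invariance is visible, as a linear
  substitution multiplies each bracket by its determinant.\<close>

lemma cubic_pairing_cubic:
  fixes a b c d
  defines "br \<equiv> \<lambda>i j. b i * c j - a i * d j"
  shows "2 * cubic_pairing (coeff (cubic a b)) (coeff (cubic c d)) =
    br 0 0 * (br (1::nat) (1::nat) * br 2 2 + br 1 2 * br 2 1) +
    br 0 1 * (br 1 0 * br 2 2 + br 1 2 * br 2 0) +
    br 0 2 * (br 1 0 * br 2 1 + br 1 1 * br 2 0)"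
  unfolding cubic_pairing_def coeff_cubic br_def by (simp add: algebra_simps)

lemma cubic_pairing_unimodular:
  assumes "p * s - q * r = 1"
  shows "cubic_pairing (coeff (cubic (\<lambda>k. p * a k + q * b k) (\<lambda>k. r * a k + s * b k)))
           (coeff (cubic (\<lambda>k. p * c k + q * d k) (\<lambda>k. r * c k + s * d k)))
       = cubic_pairing (coeff (cubic a b)) (coeff (cubic c d))"
proof -
  have br: "(r * a i + s * b i) * (p * c j + q * d j) - (p * a i + q * b i) * (r * c j + s * d j)
      = b i * c j - a i * d j" for i j
  proof -
    have "(r * a i + s * b i) * (p * c j + q * d j) - (p * a i + q * b i) * (r * c j + s * d j)
        = (p * s - q * r) * (b i * c j - a i * d j)" by (simp add: algebra_simps)
    then show ?thesis by (simp add: assms)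
  qed
  have "2 * cubic_pairing (coeff (cubic (\<lambda>k. p * a k + q * b k) (\<lambda>k. r * a k + s * b k)))
           (coeff (cubic (\<lambda>k. p * c k + q * d k) (\<lambda>k. r * c k + s * d k)))
       = 2 * cubic_pairing (coeff (cubic a b)) (coeff (cubic c d))"
    unfolding cubic_pairing_cubic br ..
  then show ?thesis by simp
qed

lemma det_cubics_unimodular:
  assumes "p * s - q * r = 1"
  shows "Determinant.det (mat 4 4 (\<lambda>(i, j).
           coeff (cubic (\<lambda>k. p * a i k + q * b i k) (\<lambda>k. r * a i k + s * b i k)) j))
       = Determinant.det (mat 4 4 (\<lambda>(i, j). coeff (cubic (a i) (b i)) j))"
proof -
  have "3 * Determinant.det (mat 4 4 (\<lambda>(i, j).
           coeff (cubic (\<lambda>k. p * a i k + q * b i k) (\<lambda>k. r * a i k + s * b i k)) j))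
       = 3 * Determinant.det (mat 4 4 (\<lambda>(i, j). coeff (cubic (a i) (b i)) j))"
    unfolding det_eq_pfaffian cubic_pairing_unimodular[OF assms] ..
  then show ?thesis by simp
qed

section \<open>The Atiyah determinant in a rotated frame\<close>

text \<open>Row \<open>i\<close> and position \<open>k\<close> count from 0, vertices from 1: this
  lists in increasing order the three vertices other than \<open>i + 1\<close>.\<close>

definition other_vertex :: "nat \<Rightarrow> nat \<Rightarrow> nat" where
  "other_vertex i k = (if k < i then k + 1 else k + 2)"

lemma atiyah_poly_cubic:
  assumes "i < 4"
  shows "atiyah_poly \<alpha> \<beta> (i + 1) =
    cubic (\<lambda>k. coeff (atiyah_ell \<alpha> \<beta> (i + 1) (other_vertex i k)) 1)
      (\<lambda>k. coeff (atiyah_ell \<alpha> \<beta> (i + 1) (other_vertex i k)) 0)"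
proof -
  have ell: "[:coeff (atiyah_ell \<alpha> \<beta> l j) 0, coeff (atiyah_ell \<alpha> \<beta> l j) 1:] = atiyah_ell \<alpha> \<beta> l j" for l j
    by (simp add: atiyah_ell_def)
  have others: "{1..4} - {i + 1} = {other_vertex i 0, other_vertex i 1, other_vertex i 2}"
    using assms by (auto simp: other_vertex_def)
  have "other_vertex i 0 \<noteq> other_vertex i 1" "other_vertex i 0 \<noteq> other_vertex i 2"
    "other_vertex i 1 \<noteq> other_vertex i 2"
    by (auto simp: other_vertex_def)
  then show ?thesis
    unfolding atiyah_poly_def cubic_def others ell by (simp add: mult.assoc)
qed

text \<open>The determinant for \<open>\<ell>\<^sub>1\<^sub>2 = 1\<close>. It has exactly one factor from \<open>\<ell>\<^sub>i\<^sub>j\<close> and one from \<open>\<ell>\<^sub>j\<^sub>i\<close> in each term, so it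
  is multilinear in the Hermitian matrices with diagonal \<open>p i j\<close>, \<open>q i j\<close> and off-diagonal \<open>w i j\<close>, \<open>u i j\<close>.\<close>

definition diagonal_form ::
  "(nat \<Rightarrow> nat \<Rightarrow> complex) \<Rightarrow> (nat \<Rightarrow> nat \<Rightarrow> complex) \<Rightarrow> (nat \<Rightarrow> nat \<Rightarrow> complex) \<Rightarrow>
    (nat \<Rightarrow> nat \<Rightarrow> complex) \<Rightarrow> complex" where
  "diagonal_form p q w u = p 1 3 * p 1 4 * p 2 3 * p 2 4 * p 3 4 + p 1 3 * p 1 4 * p 2 3 * p 2 4 * q 3 4 + p 1 3 * p 1 4 * p 2 3 * u 3 4 * w 2 4 - p 1 3 * p 1 4 * p 2 4 * u 3 4 * w 2 3
      + p 1 3 * p 2 3 * p 2 4 * q 1 4 * q 3 4 + p 1 3 * p 2 3 * p 2 4 * u 3 4 * w 1 4 + p 1 3 * p 2 3 * q 1 4 * q 2 4 * q 3 4 + p 1 3 * p 2 3 * q 1 4 * u 3 4 * w 2 4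
      + p 1 3 * p 2 3 * q 3 4 * u 1 4 * w 2 4 + p 1 3 * p 2 4 * p 3 4 * u 1 4 * w 2 3 + p 1 3 * q 1 4 * q 3 4 * u 2 3 * w 2 4 - p 1 3 * q 2 4 * q 3 4 * u 2 3 * w 1 4
      + p 1 4 * p 2 3 * p 2 4 * p 3 4 * q 1 3 - p 1 4 * p 2 3 * p 2 4 * u 3 4 * w 1 3 + p 1 4 * p 2 3 * q 3 4 * u 1 3 * w 2 4 + p 1 4 * p 2 4 * p 3 4 * q 1 3 * q 2 3
      + p 1 4 * p 2 4 * p 3 4 * u 1 3 * w 2 3 - p 1 4 * p 2 4 * q 1 3 * u 3 4 * w 2 3 + p 1 4 * p 3 4 * q 1 3 * u 2 4 * w 2 3 - p 1 4 * p 3 4 * q 2 3 * u 2 4 * w 1 3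
      + p 2 3 * p 2 4 * p 3 4 * q 1 3 * q 1 4 + p 2 3 * p 2 4 * p 3 4 * u 1 4 * w 1 3 + p 2 3 * p 2 4 * q 1 3 * q 1 4 * q 3 4 + p 2 3 * p 2 4 * q 1 3 * u 1 4 * w 3 4
      - p 2 3 * p 2 4 * q 1 4 * u 1 3 * w 3 4 + p 2 3 * p 2 4 * q 3 4 * u 1 3 * w 1 4 + p 2 3 * p 3 4 * q 1 3 * u 1 4 * w 2 4 - p 2 3 * p 3 4 * q 1 4 * u 1 3 * w 2 4
      + p 2 3 * q 1 3 * q 1 4 * q 2 4 * q 3 4 + p 2 3 * q 1 3 * q 1 4 * u 3 4 * w 2 4 + p 2 3 * q 1 3 * q 3 4 * u 1 4 * w 2 4 - p 2 3 * q 1 4 * q 2 4 * u 1 3 * w 3 4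
      + p 2 3 * q 2 4 * q 3 4 * u 1 3 * w 1 4 - p 2 3 * u 1 3 * u 1 4 * w 2 4 * w 3 4 + p 2 3 * u 1 3 * u 3 4 * w 1 4 * w 2 4 + p 2 4 * p 3 4 * q 1 3 * q 1 4 * q 2 3
      + p 2 4 * p 3 4 * q 1 4 * u 1 3 * w 2 3 + p 2 4 * p 3 4 * q 2 3 * u 1 4 * w 1 3 - p 2 4 * q 1 3 * q 1 4 * u 3 4 * w 2 3 + p 2 4 * q 1 3 * q 2 3 * u 1 4 * w 3 4
      - p 2 4 * q 1 3 * q 3 4 * u 1 4 * w 2 3 + p 2 4 * q 1 4 * q 3 4 * u 1 3 * w 2 3 + p 2 4 * u 1 3 * u 1 4 * w 2 3 * w 3 4 - p 2 4 * u 1 4 * u 3 4 * w 1 3 * w 2 3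
      + p 3 4 * q 1 3 * q 1 4 * q 2 3 * q 2 4 + p 3 4 * q 1 3 * q 1 4 * u 2 4 * w 2 3 + p 3 4 * q 1 3 * q 2 3 * u 1 4 * w 2 4 + p 3 4 * q 1 3 * q 2 4 * u 1 4 * w 2 3
      + p 3 4 * u 1 3 * u 1 4 * w 2 3 * w 2 4 + p 3 4 * u 1 4 * u 2 4 * w 1 3 * w 2 3 + q 1 3 * q 1 4 * q 2 3 * q 2 4 * q 3 4 + q 1 3 * q 1 4 * q 2 3 * u 2 4 * w 3 4
      - q 1 3 * q 1 4 * q 2 4 * u 2 3 * w 3 4 + q 1 3 * q 1 4 * q 3 4 * u 2 3 * w 2 4 + q 1 3 * q 2 3 * q 2 4 * u 1 4 * w 3 4 + q 1 3 * u 1 4 * u 2 4 * w 2 3 * w 3 4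
      - q 1 3 * u 1 4 * u 3 4 * w 2 3 * w 2 4 - q 1 4 * q 2 3 * q 2 4 * u 1 3 * w 3 4 + q 1 4 * q 2 3 * q 3 4 * u 1 3 * w 2 4 + q 1 4 * q 2 4 * q 3 4 * u 1 3 * w 2 3
      - q 1 4 * u 1 3 * u 2 3 * w 2 4 * w 3 4 + q 1 4 * u 1 3 * u 3 4 * w 2 3 * w 2 4 + q 3 4 * u 1 3 * u 1 4 * w 2 3 * w 2 4 + q 3 4 * u 1 3 * u 2 3 * w 1 4 * w 2 4"

text \<open>The coefficients of \<open>\<ell>\<^sub>j\<^sub>i\<close> are, up to sign and order, the
  conjugates of those of \<open>\<ell>\<^sub>i\<^sub>j\<close>, so each pair contributes one of
  \<open>p\<close>, \<open>q\<close>, \<open>w\<close>, \<open>u\<close> to a term. The weights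
  \<open>R\<close> are free here; later they are r_12 r_ij.\<close>

lemma det_atiyah_diagonal:
  fixes \<alpha> \<beta> R :: "nat \<Rightarrow> nat \<Rightarrow> complex"
  assumes "\<alpha> 1 2 = 0" "\<beta> 1 2 = 1"
  defines "p \<equiv> \<lambda>i j. R i j * (\<alpha> i j * cnj (\<alpha> i j))"
    and "q \<equiv> \<lambda>i j. R i j * (\<beta> i j * cnj (\<beta> i j))"
    and "w \<equiv> \<lambda>i j. R i j * (\<alpha> i j * cnj (\<beta> i j))"
    and "u \<equiv> \<lambda>i j. R i j * (\<beta> i j * cnj (\<alpha> i j))"
  shows "R 1 3 * R 1 4 * R 2 3 * R 2 4 * R 3 4 *
    Determinant.det (mat 4 4 (\<lambda>(i, j). coeff (atiyah_poly \<alpha> \<beta> (i + 1)) j)) =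
      diagonal_form p q w u"
proof -
  have mat: "mat 4 4 (\<lambda>(i, j). coeff (atiyah_poly \<alpha> \<beta> (i + 1)) j) =
    mat 4 4 (\<lambda>(i, j). coeff (cubic (\<lambda>k. coeff (atiyah_ell \<alpha> \<beta> (i + 1) (other_vertex i k)) 1)
      (\<lambda>k. coeff (atiyah_ell \<alpha> \<beta> (i + 1) (other_vertex i k)) 0)) j)"
    by (rule eq_matI) (auto simp: atiyah_poly_cubic[simplified])
  have vertices: "other_vertex 0 0 = 2" "other_vertex 0 1 = 3" "other_vertex 0 2 = 4"
    "other_vertex 1 0 = 1" "other_vertex 1 1 = 3" "other_vertex 1 2 = 4"
    "other_vertex 2 0 = 1" "other_vertex 2 1 = 2" "other_vertex 2 2 = 4"
    "other_vertex 3 0 = 1" "other_vertex 3 1 = 2" "other_vertex 3 2 = 3"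
    "0 + 1 = (1::nat)" "1 + 1 = (2::nat)" "2 + 1 = (3::nat)" "3 + 1 = (4::nat)"
    by (simp_all add: other_vertex_def)
  show ?thesis
    unfolding diagonal_form_def mat det_mat_4 coeff_cubic vertices
    using assms(1,2)
    by (simp add: atiyah_ell_def p_def q_def w_def u_def algebra_simps)
qed

text \<open>The hypotheses \<open>wu\<close> express that Hermitian matrices of rank one have
  determinant 0. The identity is formal, with \<open>u\<close> standing for the conjugate of
  \<open>w\<close>. The prefactor is r_12^4, which remains from the five weights r_12 r_ij once one
  r_12 is counted among the six edge lengths.\<close>

lemma diagonal_form_tangential:
  fixes t1 t2 t3 t4 :: complex
  assumes pq: "p 1 3 = t2 * t3" "q 1 3 = t1 * (t1 + t2 + t3)"
    "p 1 4 = t2 * t4" "q 1 4 = t1 * (t1 + t2 + t4)"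
    "p 2 3 = t2 * (t1 + t2 + t3)" "q 2 3 = t1 * t3"
    "p 2 4 = t2 * (t1 + t2 + t4)" "q 2 4 = t1 * t4"
    "p 3 4 = t1 * t3 + t2 * t4" "q 3 4 = t1 * t4 + t2 * t3"
    and w: "w 2 3 = w 1 3" "w 2 4 = w 1 4" "w 3 4 = w 1 4 - w 1 3"
    and u: "u 2 3 = u 1 3" "u 2 4 = u 1 4" "u 3 4 = u 1 4 - u 1 3"
    and wu: "w 1 3 * u 1 3 = p 1 3 * q 1 3" "w 1 4 * u 1 4 = p 1 4 * q 1 4" "w 3 4 * u 3 4 = p 3 4 * q 3 4"
  shows "diagonal_form p q w u = (t1 + t2) ^ 4 *
    ((t1 + t2) * (t1 + t3) * (t1 + t4) * (t2 + t3) * (t2 + t4) * (t3 + t4)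
     + t1 * t2 * t3 * t4 * (t1\<^sup>2 + t2\<^sup>2 + t3\<^sup>2 + t4\<^sup>2
         + 6 * (t1 * t2 + t1 * t3 + t1 * t4 + t2 * t3 + t2 * t4 + t3 * t4))
     - ((t2 * t3 * t4)\<^sup>2 + (t1 * t3 * t4)\<^sup>2 + (t1 * t2 * t4)\<^sup>2 + (t1 * t2 * t3)\<^sup>2))"
proof -
  define z where "z = w 1 3"
  define z' where "z' = u 1 3"
  define y where "y = w 1 4"
  define y' where "y' = u 1 4"
  define S where "S = z * y' + y * z'"
  define m where "m = t1 * t2 * t3 * (t1 + t2 + t3)"
  define n where "n = t1 * t2 * t4 * (t1 + t2 + t4)"
  have zz: "z * z' = m" and yy: "y * y' = n"
    unfolding z_def z'_def y_def y'_def wu pq m_def n_def by (simp_all add: mult_ac)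
  \<comment> \<open>The third equation of \<open>wu\<close> reads (y - z)(y' - z') = p_34 q_34, and
    expanding it determines \<open>S\<close>.\<close>
  have S: "S = m + n - (t1 * t3 + t2 * t4) * (t1 * t4 + t2 * t3)"
    using wu(3) unfolding w u pq zz[symmetric] yy[symmetric] S_def z_def z'_def y_def y'_def
    by (simp add: algebra_simps)
  \<comment> \<open>Sorted by monomials in \<open>z\<close>, \<open>z'\<close>, \<open>y\<close>,
    \<open>y'\<close>; each contains as many primed as unprimed factors.\<close>
  have "diagonal_form p q w u =
     (p 1 3 * p 1 4 * p 2 3 * p 2 4 * p 3 4 + p 1 3 * p 1 4 * p 2 3 * p 2 4 * q 3 4 + p 1 3 * p 2 3 * p 2 4 * q 1 4 * q 3 4 + p 1 3 * p 2 3 * q 1 4 * q 2 4 * q 3 4 + p 1 4 * p 2 3 * p 2 4 * p 3 4 * q 1 3 + p 1 4 * p 2 4 * p 3 4 * q 1 3 * q 2 3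
      + p 2 3 * p 2 4 * p 3 4 * q 1 3 * q 1 4 + p 2 3 * p 2 4 * q 1 3 * q 1 4 * q 3 4 + p 2 3 * q 1 3 * q 1 4 * q 2 4 * q 3 4 + p 2 4 * p 3 4 * q 1 3 * q 1 4 * q 2 3 + p 3 4 * q 1 3 * q 1 4 * q 2 3 * q 2 4 + q 1 3 * q 1 4 * q 2 3 * q 2 4 * q 3 4)
     + (p 1 3 * p 1 4 * p 2 4 + p 1 4 * p 2 3 * p 2 4 + p 1 4 * p 2 4 * p 3 4 + p 1 4 * p 2 4 * q 1 3 + p 2 3 * p 2 4 * q 1 4 + p 2 3 * q 1 4 * q 2 4
      + p 2 4 * p 3 4 * q 1 4 + p 2 4 * q 1 3 * q 1 4 + p 2 4 * q 1 4 * q 3 4 + q 1 3 * q 1 4 * q 2 4 + q 1 4 * q 2 3 * q 2 4 + q 1 4 * q 2 4 * q 3 4) * (z * z')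
     + (p 1 3 * p 1 4 * p 2 3 + p 1 3 * p 2 3 * p 2 4 + p 1 3 * p 2 3 * q 1 4 + p 1 3 * p 2 3 * q 3 4 + p 2 3 * p 2 4 * q 1 3 + p 2 3 * p 3 4 * q 1 3
      + p 2 3 * q 1 3 * q 1 4 + p 2 3 * q 1 3 * q 3 4 + p 2 4 * q 1 3 * q 2 3 + p 3 4 * q 1 3 * q 2 3 + q 1 3 * q 1 4 * q 2 3 + q 1 3 * q 2 3 * q 2 4) * (y * y')
     + (- p 1 3 * p 1 4 * p 2 4 + p 1 3 * p 2 4 * p 3 4 - p 1 4 * p 2 3 * p 2 4 - p 1 4 * p 2 4 * q 1 3 + p 1 4 * p 3 4 * q 1 3 - p 1 4 * p 3 4 * q 2 3
      + p 2 3 * p 2 4 * p 3 4 - p 2 3 * p 2 4 * q 1 3 + p 2 4 * p 3 4 * q 2 3 - p 2 4 * q 1 3 * q 1 4 - p 2 4 * q 1 3 * q 2 3 - p 2 4 * q 1 3 * q 3 4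
      + p 3 4 * q 1 3 * q 1 4 + p 3 4 * q 1 3 * q 2 4 - q 1 3 * q 1 4 * q 2 3 - q 1 3 * q 2 3 * q 2 4) * (z * y')
     + (- p 1 3 * p 1 4 * p 2 3 - p 1 3 * p 2 3 * p 2 4 - p 1 3 * p 2 3 * q 1 4 + p 1 3 * q 1 4 * q 3 4 - p 1 3 * q 2 4 * q 3 4 + p 1 4 * p 2 3 * q 3 4
      - p 2 3 * p 2 4 * q 1 4 + p 2 3 * p 2 4 * q 3 4 - p 2 3 * p 3 4 * q 1 4 - p 2 3 * q 1 3 * q 1 4 - p 2 3 * q 1 4 * q 2 4 + p 2 3 * q 2 4 * q 3 4
      - q 1 3 * q 1 4 * q 2 4 + q 1 3 * q 1 4 * q 3 4 - q 1 4 * q 2 3 * q 2 4 + q 1 4 * q 2 3 * q 3 4) * (y * z')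
     + (- p 2 4 + p 3 4 - q 1 3) * (z * y')\<^sup>2 + (- p 2 3 - q 1 4 + q 3 4) * (y * z')\<^sup>2
     + (p 2 3 + p 2 4 + p 3 4 + q 1 3 + q 1 4 + q 3 4) * ((z * z') * (y * y'))"
    unfolding diagonal_form_def w u z_def[symmetric] z'_def[symmetric] y_def[symmetric] y'_def[symmetric]
    by (simp add: algebra_simps power2_eq_square)
  note expansion = this
  define s where "s = t1 + t2"
  define P where "P = t1 * t2"
  define A where "A = s + t3"
  define B where "B = s + t4"
  define M where "M = t1 * t3 + t2 * t4"
  define N where "N = t1 * t4 + t2 * t3"
  define K where "K = s^3 - 3 * P * s"
  \<comment> \<open>The coefficients are symmetric in \<open>t1\<close> and \<open>t2\<close>.\<close>
  note abbreviations = s_def[symmetric] A_def[symmetric] B_def[symmetric] M_def[symmetric] N_def[symmetric]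
  note pq' = pq[unfolded abbreviations]
  have K: "t1^3 + t2^3 = K" and K4: "t1^4 + t2^4 = s^4 - 4 * P * s\<^sup>2 + 2 * P\<^sup>2"
    and MN: "M + N = s * (t3 + t4)"
    by (simp_all add: K_def s_def P_def M_def N_def algebra_simps power2_eq_square power3_eq_cube power4_eq_xxxx)
  \<comment> \<open>Exchanging \<open>t1\<close> and \<open>t2\<close> exchanges \<open>M\<close>
    and \<open>N\<close>, so they enter the symmetric coefficients only through \<open>M + N\<close>
    and these two sums.\<close>
  have KN: "t1\<^sup>2 * M + t2\<^sup>2 * N = P * s * t4 + K * t3" and KM: "t2\<^sup>2 * M + t1\<^sup>2 * N = P * s * t3 + K * t4"
    unfolding K[symmetric] s_def P_def M_def N_def
    by (simp_all add: algebra_simps power2_eq_square power3_eq_cube)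
  have c0: "p 1 3 * p 1 4 * p 2 3 * p 2 4 * p 3 4 + p 1 3 * p 1 4 * p 2 3 * p 2 4 * q 3 4 + p 1 3 * p 2 3 * p 2 4 * q 1 4 * q 3 4 + p 1 3 * p 2 3 * q 1 4 * q 2 4 * q 3 4 + p 1 4 * p 2 3 * p 2 4 * p 3 4 * q 1 3 + p 1 4 * p 2 4 * p 3 4 * q 1 3 * q 2 3
      + p 2 3 * p 2 4 * p 3 4 * q 1 3 * q 1 4 + p 2 3 * p 2 4 * q 1 3 * q 1 4 * q 3 4 + p 2 3 * q 1 3 * q 1 4 * q 2 4 * q 3 4 + p 2 4 * p 3 4 * q 1 3 * q 1 4 * q 2 3 + p 3 4 * q 1 3 * q 1 4 * q 2 3 * q 2 4 + q 1 3 * q 1 4 * q 2 3 * q 2 4 * q 3 4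
      = A * B * ((s^4 - 4 * P * s\<^sup>2 + 3 * P\<^sup>2) * (t3 * t4) * (s * (t3 + t4)) + P\<^sup>2 * (A * B) * (s * (t3 + t4))
        + P * (t3 * B * (P * s * t4 + K * t3) + t4 * A * (P * s * t3 + K * t4)))"
  proof -
    have "p 1 3 * p 1 4 * p 2 3 * p 2 4 * p 3 4 + p 1 3 * p 1 4 * p 2 3 * p 2 4 * q 3 4 + p 1 3 * p 2 3 * p 2 4 * q 1 4 * q 3 4 + p 1 3 * p 2 3 * q 1 4 * q 2 4 * q 3 4 + p 1 4 * p 2 3 * p 2 4 * p 3 4 * q 1 3 + p 1 4 * p 2 4 * p 3 4 * q 1 3 * q 2 3
      + p 2 3 * p 2 4 * p 3 4 * q 1 3 * q 1 4 + p 2 3 * p 2 4 * q 1 3 * q 1 4 * q 3 4 + p 2 3 * q 1 3 * q 1 4 * q 2 4 * q 3 4 + p 2 4 * p 3 4 * q 1 3 * q 1 4 * q 2 3 + p 3 4 * q 1 3 * q 1 4 * q 2 3 * q 2 4 + q 1 3 * q 1 4 * q 2 3 * q 2 4 * q 3 4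
      = A * B * (((t1^4 + t2^4) + P\<^sup>2) * (t3 * t4) * (M + N) + P\<^sup>2 * (A * B) * (M + N)
        + P * (t3 * B * (t1\<^sup>2 * M + t2\<^sup>2 * N) + t4 * A * (t2\<^sup>2 * M + t1\<^sup>2 * N)))"
      unfolding pq' P_def by (simp add: algebra_simps power2_eq_square power4_eq_xxxx)
    then show ?thesis unfolding K4 MN KN KM by simp
  qed
  have c1: "p 1 3 * p 1 4 * p 2 4 + p 1 4 * p 2 3 * p 2 4 + p 1 4 * p 2 4 * p 3 4 + p 1 4 * p 2 4 * q 1 3 + p 2 3 * p 2 4 * q 1 4 + p 2 3 * q 1 4 * q 2 4
      + p 2 4 * p 3 4 * q 1 4 + p 2 4 * q 1 3 * q 1 4 + p 2 4 * q 1 4 * q 3 4 + q 1 3 * q 1 4 * q 2 4 + q 1 4 * q 2 3 * q 2 4 + q 1 4 * q 2 4 * q 3 4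
      = B * (K * t4 * (t3 + A) + t4 * (P * s * t3 + K * t4) + P * s * A * t4 + P * s * A * B + P * B * (s * (t3 + t4)))"
  proof -
    have "p 1 3 * p 1 4 * p 2 4 + p 1 4 * p 2 3 * p 2 4 + p 1 4 * p 2 4 * p 3 4 + p 1 4 * p 2 4 * q 1 3 + p 2 3 * p 2 4 * q 1 4 + p 2 3 * q 1 4 * q 2 4
      + p 2 4 * p 3 4 * q 1 4 + p 2 4 * q 1 3 * q 1 4 + p 2 4 * q 1 4 * q 3 4 + q 1 3 * q 1 4 * q 2 4 + q 1 4 * q 2 3 * q 2 4 + q 1 4 * q 2 4 * q 3 4
      = B * ((t1^3 + t2^3) * t4 * (t3 + A) + t4 * (t2\<^sup>2 * M + t1\<^sup>2 * N) + P * s * A * t4 + P * s * A * B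
        + P * B * (M + N))"
      unfolding pq' P_def s_def by (simp add: algebra_simps power2_eq_square power3_eq_cube)
    then show ?thesis unfolding K MN KM .
  qed
  have c2: "p 1 3 * p 1 4 * p 2 3 + p 1 3 * p 2 3 * p 2 4 + p 1 3 * p 2 3 * q 1 4 + p 1 3 * p 2 3 * q 3 4 + p 2 3 * p 2 4 * q 1 3 + p 2 3 * p 3 4 * q 1 3
      + p 2 3 * q 1 3 * q 1 4 + p 2 3 * q 1 3 * q 3 4 + p 2 4 * q 1 3 * q 2 3 + p 3 4 * q 1 3 * q 2 3 + q 1 3 * q 1 4 * q 2 3 + q 1 3 * q 2 3 * q 2 4
      = A * (K * t3 * (t4 + B) + t3 * (P * s * t4 + K * t3) + P * s * B * t3 + P * s * A * B + P * A * (s * (t3 + t4)))"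
  proof -
    have "p 1 3 * p 1 4 * p 2 3 + p 1 3 * p 2 3 * p 2 4 + p 1 3 * p 2 3 * q 1 4 + p 1 3 * p 2 3 * q 3 4 + p 2 3 * p 2 4 * q 1 3 + p 2 3 * p 3 4 * q 1 3
      + p 2 3 * q 1 3 * q 1 4 + p 2 3 * q 1 3 * q 3 4 + p 2 4 * q 1 3 * q 2 3 + p 3 4 * q 1 3 * q 2 3 + q 1 3 * q 1 4 * q 2 3 + q 1 3 * q 2 3 * q 2 4
      = A * ((t1^3 + t2^3) * t3 * (t4 + B) + t3 * (t1\<^sup>2 * M + t2\<^sup>2 * N) + P * s * B * t3 + P * s * A * B
        + P * A * (M + N))"
      unfolding pq' P_def s_def by (simp add: algebra_simps power2_eq_square power3_eq_cube)
    then show ?thesis unfolding K MN KN .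
  qed
  have c5: "p 2 3 + p 2 4 + p 3 4 + q 1 3 + q 1 4 + q 3 4 = s * (A + B) + s * (t3 + t4)"
    unfolding pq' MN[symmetric] unfolding s_def by (simp add: M_def N_def algebra_simps)
  \<comment> \<open>The coefficients of \<open>z * y'\<close> and \<open>y * z'\<close> coincide, as
    do those of their squares. Hence only \<open>S\<close> and the sum of squares
    \<open>S\<^sup>2 - 2 * (m * n)\<close> occur.\<close>
  have c3: "- p 1 3 * p 1 4 * p 2 4 + p 1 3 * p 2 4 * p 3 4 - p 1 4 * p 2 3 * p 2 4 - p 1 4 * p 2 4 * q 1 3 + p 1 4 * p 3 4 * q 1 3 - p 1 4 * p 3 4 * q 2 3
      + p 2 3 * p 2 4 * p 3 4 - p 2 3 * p 2 4 * q 1 3 + p 2 4 * p 3 4 * q 2 3 - p 2 4 * q 1 3 * q 1 4 - p 2 4 * q 1 3 * q 2 3 - p 2 4 * q 1 3 * q 3 4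
      + p 3 4 * q 1 3 * q 1 4 + p 3 4 * q 1 3 * q 2 4 - q 1 3 * q 1 4 * q 2 3 - q 1 3 * q 2 3 * q 2 4
      = - (P * s\<^sup>2 * (2 * t3 * t4 + 2 * s * (t3 + t4) + s\<^sup>2))"
    and d3: "- p 1 3 * p 1 4 * p 2 3 - p 1 3 * p 2 3 * p 2 4 - p 1 3 * p 2 3 * q 1 4 + p 1 3 * q 1 4 * q 3 4 - p 1 3 * q 2 4 * q 3 4 + p 1 4 * p 2 3 * q 3 4
      - p 2 3 * p 2 4 * q 1 4 + p 2 3 * p 2 4 * q 3 4 - p 2 3 * p 3 4 * q 1 4 - p 2 3 * q 1 3 * q 1 4 - p 2 3 * q 1 4 * q 2 4 + p 2 3 * q 2 4 * q 3 4
      - q 1 3 * q 1 4 * q 2 4 + q 1 3 * q 1 4 * q 3 4 - q 1 4 * q 2 3 * q 2 4 + q 1 4 * q 2 3 * q 3 4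
      = - (P * s\<^sup>2 * (2 * t3 * t4 + 2 * s * (t3 + t4) + s\<^sup>2))"
    and c4: "- p 2 4 + p 3 4 - q 1 3 = - s\<^sup>2" and d4: "- p 2 3 - q 1 4 + q 3 4 = - s\<^sup>2"
    unfolding pq s_def P_def by (simp_all add: algebra_simps power2_eq_square)
  have m: "m = P * t3 * A" and n: "n = P * t4 * B"
    by (simp_all add: m_def n_def s_def P_def A_def B_def mult_ac)
  have S': "S = P * s * (t3 + t4) - (s\<^sup>2 - 2 * P) * (t3 * t4)"
    unfolding S m_def n_def s_def P_def by (simp add: algebra_simps power2_eq_square)
  have "diagonal_form p q w u =
     (p 1 3 * p 1 4 * p 2 3 * p 2 4 * p 3 4 + p 1 3 * p 1 4 * p 2 3 * p 2 4 * q 3 4 + p 1 3 * p 2 3 * p 2 4 * q 1 4 * q 3 4 + p 1 3 * p 2 3 * q 1 4 * q 2 4 * q 3 4 + p 1 4 * p 2 3 * p 2 4 * p 3 4 * q 1 3 + p 1 4 * p 2 4 * p 3 4 * q 1 3 * q 2 3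
      + p 2 3 * p 2 4 * p 3 4 * q 1 3 * q 1 4 + p 2 3 * p 2 4 * q 1 3 * q 1 4 * q 3 4 + p 2 3 * q 1 3 * q 1 4 * q 2 4 * q 3 4 + p 2 4 * p 3 4 * q 1 3 * q 1 4 * q 2 3 + p 3 4 * q 1 3 * q 1 4 * q 2 3 * q 2 4 + q 1 3 * q 1 4 * q 2 3 * q 2 4 * q 3 4)
     + (p 1 3 * p 1 4 * p 2 4 + p 1 4 * p 2 3 * p 2 4 + p 1 4 * p 2 4 * p 3 4 + p 1 4 * p 2 4 * q 1 3 + p 2 3 * p 2 4 * q 1 4 + p 2 3 * q 1 4 * q 2 4
      + p 2 4 * p 3 4 * q 1 4 + p 2 4 * q 1 3 * q 1 4 + p 2 4 * q 1 4 * q 3 4 + q 1 3 * q 1 4 * q 2 4 + q 1 4 * q 2 3 * q 2 4 + q 1 4 * q 2 4 * q 3 4) * m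
     + (p 1 3 * p 1 4 * p 2 3 + p 1 3 * p 2 3 * p 2 4 + p 1 3 * p 2 3 * q 1 4 + p 1 3 * p 2 3 * q 3 4 + p 2 3 * p 2 4 * q 1 3 + p 2 3 * p 3 4 * q 1 3
      + p 2 3 * q 1 3 * q 1 4 + p 2 3 * q 1 3 * q 3 4 + p 2 4 * q 1 3 * q 2 3 + p 3 4 * q 1 3 * q 2 3 + q 1 3 * q 1 4 * q 2 3 + q 1 3 * q 2 3 * q 2 4) * n
     - P * s\<^sup>2 * (2 * t3 * t4 + 2 * s * (t3 + t4) + s\<^sup>2) * S
     - s\<^sup>2 * (S\<^sup>2 - 2 * (m * n))
     + (p 2 3 + p 2 4 + p 3 4 + q 1 3 + q 1 4 + q 3 4) * (m * n)"
    unfolding expansion c3 d3 c4 d4 unfolding zz[symmetric] yy[symmetric] S_def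
    by (simp add: algebra_simps power2_eq_square)
  \<comment> \<open>The factors in the target are (t1 + t3)(t2 + t3) = P + s t3 + t3^2, its analogue
    for \<open>t4\<close>, and t1^2 + t2^2 = s^2 - 2P.\<close>
  also have "\<dots> = s^4 *
    (s * (P + s * t3 + t3\<^sup>2) * (P + s * t4 + t4\<^sup>2) * (t3 + t4)
     + P * t3 * t4 * (s\<^sup>2 - 2 * P + t3\<^sup>2 + t4\<^sup>2 + 6 * (P + s * (t3 + t4) + t3 * t4))
     - ((s\<^sup>2 - 2 * P) * (t3 * t4)\<^sup>2 + P\<^sup>2 * (t3\<^sup>2 + t4\<^sup>2)))"
    unfolding c0 c1 c2 c5 m n S' A_def B_def K_def
    by (simp add: algebra_simps power2_eq_square power3_eq_cube power4_eq_xxxx)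
  also have "\<dots> = (t1 + t2) ^ 4 *
    ((t1 + t2) * (t1 + t3) * (t1 + t4) * (t2 + t3) * (t2 + t4) * (t3 + t4)
     + t1 * t2 * t3 * t4 * (t1\<^sup>2 + t2\<^sup>2 + t3\<^sup>2 + t4\<^sup>2
         + 6 * (t1 * t2 + t1 * t3 + t1 * t4 + t2 * t3 + t2 * t4 + t3 * t4))
     - ((t2 * t3 * t4)\<^sup>2 + (t1 * t3 * t4)\<^sup>2 + (t1 * t2 * t4)\<^sup>2 + (t1 * t2 * t3)\<^sup>2))"
    by (rule arg_cong2[where f = "(*)"]) (simp_all add: s_def P_def algebra_simps power2_eq_square)
  finally show ?thesis .
qed

section \<open>Tangential configurations\<close>

text \<open>The free phase of (a, b) cancels in these products. Up to order and signs they are the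
  entries of the projection (1 + \<sigma> u)/2 belonging to the direction \<open>u\<close>.\<close>

lemma stereo_products:
  fixes u :: "real^3" and a b :: complex
  assumes u: "inner u u = 1" and ab: "(cmod a)\<^sup>2 + (cmod b)\<^sup>2 = 1"
    and root: "case stereo u of None \<Rightarrow> a = 0 | Some s \<Rightarrow> a * s + b = 0"
  shows "a * cnj a = of_real ((1 - u $ 3) / 2)" "b * cnj b = of_real ((1 + u $ 3) / 2)"
    "a * cnj b = - Complex (u $ 1 / 2) (- u $ 2 / 2)"
proof -
  have u2: "(u $ 1)\<^sup>2 + (u $ 2)\<^sup>2 = (1 - u $ 3) * (1 + u $ 3)"
    using u by (simp add: inner_vec_def sum_3 algebra_simps power2_eq_square)
  have "(cmod a)\<^sup>2 = (1 - u $ 3) / 2 \<and> (cmod b)\<^sup>2 = (1 + u $ 3) / 2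
      \<and> a * cnj b = - Complex (u $ 1 / 2) (- u $ 2 / 2)"
  proof (cases "u $ 3 = 1")
    case True
    with root have "a = 0" by (simp add: stereo_def)
    moreover from u2 True have "u $ 1 = 0" "u $ 2 = 0" by (simp_all add: sum_power2_eq_zero_iff)
    moreover from ab \<open>a = 0\<close> have "(cmod b)\<^sup>2 = 1" by simp
    ultimately show ?thesis using True by (simp add: complex_eq_iff)
  next
    case False
    \<comment> \<open>Away from the pole the root \<open>s\<close> is finite with |s|^2 = (1 +
      u_3)/(1 - u_3), and the normalization then fixes |a|^2.\<close>
    define d where "d = 1 - u $ 3"
    define s where "s = Complex (u $ 1 / d) (u $ 2 / d)"
    from False have d: "d \<noteq> 0" by (simp add: d_def)
    from root False have b: "b = - (a * s)"
      by (simp add: stereo_def s_def d_def eq_neg_iff_add_eq_0 add.commute)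
    have "(cmod s)\<^sup>2 = ((u $ 1)\<^sup>2 + (u $ 2)\<^sup>2) / d\<^sup>2"
      by (simp add: s_def cmod_power2 power_divide add_divide_distrib)
    also have "\<dots> = (1 + u $ 3) / d"
      unfolding u2 d_def[symmetric] using d by (simp add: power2_eq_square)
    finally have s: "(cmod s)\<^sup>2 = (1 + u $ 3) / d" .
    have "(cmod a)\<^sup>2 * (1 + (cmod s)\<^sup>2) = 1"
      using ab by (simp add: b norm_mult power_mult_distrib algebra_simps)
    moreover have "1 + (cmod s)\<^sup>2 = 2 / d" unfolding s using d by (simp add: field_simps d_def)
    ultimately have a: "(cmod a)\<^sup>2 = d / 2" using d by (simp add: field_simps)
    have "a * cnj b = - (of_real ((cmod a)\<^sup>2) * cnj s)"
      unfolding complex_norm_square by (simp add: b)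
    also have "\<dots> = - Complex (u $ 1 / 2) (- u $ 2 / 2)"
      unfolding a using d by (simp add: s_def complex_eq_iff)
    finally have "a * cnj b = - Complex (u $ 1 / 2) (- u $ 2 / 2)" .
    moreover have "(cmod b)\<^sup>2 = (1 + u $ 3) / 2" using ab a by (simp add: d_def field_simps)
    ultimately show ?thesis using a by (simp add: d_def)
  qed
  then show "a * cnj a = of_real ((1 - u $ 3) / 2)" "b * cnj b = of_real ((1 + u $ 3) / 2)"
    "a * cnj b = - Complex (u $ 1 / 2) (- u $ 2 / 2)"
    by (simp_all add: complex_norm_square[symmetric] del: of_real_divide of_real_power)
qed

lemma admissible_products:
  assumes adm: "admissible_choice x \<alpha> \<beta>" and ij: "i \<in> {1..4}" "j \<in> {1..4}" "i < j"
    and ne: "x i \<noteq> x j"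
  defines "r \<equiv> edge_len x i j" and "v \<equiv> x j - x i"
  shows "2 * of_real r * (\<alpha> i j * cnj (\<alpha> i j)) = of_real (r - v $ 3)"
    "2 * of_real r * (\<beta> i j * cnj (\<beta> i j)) = of_real (r + v $ 3)"
    "2 * of_real r * (\<alpha> i j * cnj (\<beta> i j)) = - Complex (v $ 1) (- v $ 2)"
proof -
  define n where "n = v /\<^sub>R r"
  have r: "r > 0" using ne by (simp add: r_def edge_len_def)
  have "norm v = r" by (simp add: r_def v_def edge_len_def dist_norm norm_minus_commute)
  with r have "inner n n = 1" by (simp add: n_def power2_norm_eq_inner[symmetric] power2_eq_square)
  moreover from adm ij have "(cmod (\<alpha> i j))\<^sup>2 + (cmod (\<beta> i j))\<^sup>2 = 1"
    "case stereo n of None \<Rightarrow> \<alpha> i j = 0 | Some t \<Rightarrow> \<alpha> i j * t + \<beta> i j = 0"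
    by (auto simp: admissible_choice_def atiyah_root_def n_def v_def r_def)
  ultimately have *: "\<alpha> i j * cnj (\<alpha> i j) = of_real ((1 - n $ 3) / 2)"
    "\<beta> i j * cnj (\<beta> i j) = of_real ((1 + n $ 3) / 2)"
    "\<alpha> i j * cnj (\<beta> i j) = - Complex (n $ 1 / 2) (- n $ 2 / 2)"
    by (rule stereo_products)+
  show "2 * of_real r * (\<alpha> i j * cnj (\<alpha> i j)) = of_real (r - v $ 3)"
    "2 * of_real r * (\<beta> i j * cnj (\<beta> i j)) = of_real (r + v $ 3)"
    "2 * of_real r * (\<alpha> i j * cnj (\<beta> i j)) = - Complex (v $ 1) (- v $ 2)"
    unfolding * using r by (simp_all add: n_def complex_eq_iff field_simps)
qed

text \<open>The rotated spinor \<open>(b\<^sub>0 a - a\<^sub>0 b, cnj a\<^sub>0 a + cnj b\<^sub>0 b)\<close> describes the direction of \<open>v\<close> in a frame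
  whose third axis is \<open>v\<^sub>0\<close>.\<close>

lemma rotated_products:
  fixes a0 b0 a b :: complex and r0 r :: real and v0 v :: "real^3"
  defines "a' \<equiv> b0 * a - a0 * b" and "b' \<equiv> cnj a0 * a + cnj b0 * b"
  assumes v: "2 * of_real r * (a * cnj a) = of_real (r - v $ 3)"
    "2 * of_real r * (b * cnj b) = of_real (r + v $ 3)"
    "2 * of_real r * (a * cnj b) = - Complex (v $ 1) (- v $ 2)"
  shows "2 * of_real r * (a' * cnj b') =
      Complex (v $ 1) (v $ 2) * a0\<^sup>2 - 2 * of_real (v $ 3) * a0 * b0 - Complex (v $ 1) (- v $ 2) * b0\<^sup>2" (is ?W)
    and "2 * of_real r0 * (a0 * cnj a0) = of_real (r0 - v0 $ 3) \<Longrightarrow>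
      2 * of_real r0 * (b0 * cnj b0) = of_real (r0 + v0 $ 3) \<Longrightarrow>
      2 * of_real r0 * (a0 * cnj b0) = - Complex (v0 $ 1) (- v0 $ 2) \<Longrightarrow>
      of_real (r0 * r) * (a' * cnj a') = of_real ((r0 * r - inner v0 v) / 2) \<and>
      of_real (r0 * r) * (b' * cnj b') = of_real ((r0 * r + inner v0 v) / 2)"
proof -
  have conj: "2 * of_real s * (d * cnj c) = - Complex (w $ 1) (w $ 2)"
    if "2 * of_real s * (c * cnj d) = - Complex (w $ 1) (- w $ 2)" for s c d and w :: "real^3"
    using arg_cong[OF that, of cnj] by (simp add: mult.commute complex_eq_iff)
  have quarter: "z = of_real (y / 2)" if "4 * z = of_real (2 * y)" for z :: complex and y
    using that by (simp add: complex_eq_iff)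
  have "2 * of_real r * (a' * cnj b') =
      (2 * of_real r * (a * cnj a)) * (a0 * b0) + (2 * of_real r * (a * cnj b)) * b0\<^sup>2
      - (2 * of_real r * (b * cnj a)) * a0\<^sup>2 - (2 * of_real r * (b * cnj b)) * (a0 * b0)"
    by (simp add: a'_def b'_def algebra_simps power2_eq_square)
  also have "\<dots> = Complex (v $ 1) (v $ 2) * a0\<^sup>2 - 2 * of_real (v $ 3) * a0 * b0 - Complex (v $ 1) (- v $ 2) * b0\<^sup>2"
    unfolding v conj[OF v(3)] by (simp add: algebra_simps)
  finally show ?W .
  assume v0: "2 * of_real r0 * (a0 * cnj a0) = of_real (r0 - v0 $ 3)"
      "2 * of_real r0 * (b0 * cnj b0) = of_real (r0 + v0 $ 3)"
      "2 * of_real r0 * (a0 * cnj b0) = - Complex (v0 $ 1) (- v0 $ 2)"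
  have inner: "inner v0 v = v0 $ 1 * v $ 1 + v0 $ 2 * v $ 2 + v0 $ 3 * v $ 3"
    by (simp add: inner_vec_def sum_3)
  \<comment> \<open>Each summand has one entry of the matrix of \<open>v0\<close> and one of that of
    \<open>v\<close>; this bilinear pairing of the two matrices produces the inner product of the
    vectors.\<close>
  have "4 * (of_real (r0 * r) * (a' * cnj a')) =
      (2 * of_real r0 * (b0 * cnj b0)) * (2 * of_real r * (a * cnj a))
    + (2 * of_real r0 * (a0 * cnj a0)) * (2 * of_real r * (b * cnj b))
    - (2 * of_real r0 * (b0 * cnj a0)) * (2 * of_real r * (a * cnj b))
    - (2 * of_real r0 * (a0 * cnj b0)) * (2 * of_real r * (b * cnj a))"
    by (simp add: a'_def algebra_simps)
  also have "\<dots> = of_real (2 * (r0 * r - inner v0 v))"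
    unfolding v v0 conj[OF v(3)] conj[OF v0(3)] inner by (simp add: complex_eq_iff algebra_simps)
  finally have 1: "of_real (r0 * r) * (a' * cnj a') = of_real ((r0 * r - inner v0 v) / 2)"
    by (rule quarter)
  have "4 * (of_real (r0 * r) * (b' * cnj b')) =
      (2 * of_real r0 * (a0 * cnj a0)) * (2 * of_real r * (a * cnj a))
    + (2 * of_real r0 * (b0 * cnj b0)) * (2 * of_real r * (b * cnj b))
    + (2 * of_real r0 * (b0 * cnj a0)) * (2 * of_real r * (a * cnj b))
    + (2 * of_real r0 * (a0 * cnj b0)) * (2 * of_real r * (b * cnj a))"
    by (simp add: b'_def algebra_simps)
  also have "\<dots> = of_real (2 * (r0 * r + inner v0 v))"
    unfolding v v0 conj[OF v(3)] conj[OF v0(3)] inner by (simp add: complex_eq_iff algebra_simps)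
  finally have 2: "of_real (r0 * r) * (b' * cnj b') = of_real ((r0 * r + inner v0 v) / 2)"
    by (rule quarter)
  from 1 2 show "of_real (r0 * r) * (a' * cnj a') = of_real ((r0 * r - inner v0 v) / 2) \<and>
      of_real (r0 * r) * (b' * cnj b') = of_real ((r0 * r + inner v0 v) / 2)" ..
qed

text \<open>Elements of SU(2) commute with the antipodal map, so the rotated
  \<open>\<ell>\<^sub>j\<^sub>i\<close> is again built from the rotated
  \<open>\<ell>\<^sub>i\<^sub>j\<close> by the same rule, and one unimodular substitution acts on
  all linear factors.\<close>

lemma det_atiyah_rotate:
  fixes \<alpha> \<beta> :: "nat \<Rightarrow> nat \<Rightarrow> complex" and a0 b0 :: complex
  assumes "(cmod a0)\<^sup>2 + (cmod b0)\<^sup>2 = 1"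
  defines "\<alpha>' \<equiv> \<lambda>i j. b0 * \<alpha> i j - a0 * \<beta> i j" and "\<beta>' \<equiv> \<lambda>i j. cnj a0 * \<alpha> i j + cnj b0 * \<beta> i j"
  shows "Determinant.det (mat 4 4 (\<lambda>(i, j). coeff (atiyah_poly \<alpha>' \<beta>' (i + 1)) j)) =
    Determinant.det (mat 4 4 (\<lambda>(i, j). coeff (atiyah_poly \<alpha> \<beta> (i + 1)) j))"
proof -
  have cubics: "mat 4 4 (\<lambda>(i, j). coeff (atiyah_poly \<alpha> \<beta> (i + 1)) j) =
    mat 4 4 (\<lambda>(i, j). coeff (cubic (\<lambda>k. coeff (atiyah_ell \<alpha> \<beta> (i + 1) (other_vertex i k)) 1)
      (\<lambda>k. coeff (atiyah_ell \<alpha> \<beta> (i + 1) (other_vertex i k)) 0)) j)" for \<alpha> \<beta>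
    by (rule eq_matI) (auto simp: atiyah_poly_cubic[simplified])
  have "coeff (atiyah_ell \<alpha>' \<beta>' i j) 1
      = b0 * coeff (atiyah_ell \<alpha> \<beta> i j) 1 + (- a0) * coeff (atiyah_ell \<alpha> \<beta> i j) 0"
    and "coeff (atiyah_ell \<alpha>' \<beta>' i j) 0
      = cnj a0 * coeff (atiyah_ell \<alpha> \<beta> i j) 1 + cnj b0 * coeff (atiyah_ell \<alpha> \<beta> i j) 0" for i j
    by (simp_all add: atiyah_ell_def \<alpha>'_def \<beta>'_def)
  moreover have "b0 * cnj b0 - (- a0) * cnj a0 = 1"
    using arg_cong[OF assms(1), of complex_of_real] by (simp add: complex_norm_square add.commute del: of_real_power)
  ultimately show ?thesis
    unfolding cubics by (simp only: det_cubics_unimodular)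
qed

section \<open>Index sets made explicit\<close>

lemma vertex_pairs:
  "{(i, j). 1 \<le> i \<and> i < j \<and> j \<le> 4} = {(1, 2), (1, 3), (1, 4), (2, 3), (2, 4), (3, 4::nat)}"
proof -
  have "1 \<le> i \<and> i < j \<and> j \<le> 4 \<longleftrightarrow> i = 1 \<and> j = 2 \<or> i = 1 \<and> j = 3 \<or> i = 1 \<and> j = 4 \<or>
      i = 2 \<and> j = 3 \<or> i = 2 \<and> j = 4 \<or> i = 3 \<and> j = 4" for i j :: nat
    by presburger
  then show ?thesis by auto
qed

lemma vertex_triples:
  "{(i, j, k). 1 \<le> i \<and> i < j \<and> j < k \<and> k \<le> 4} = {(1, 2, 3), (1, 2, 4), (1, 3, 4), (2, 3, 4::nat)}"
proof -
  have "1 \<le> i \<and> i < j \<and> j < k \<and> k \<le> 4 \<longleftrightarrow> i = 1 \<and> j = 2 \<and> k = 3 \<or> i = 1 \<and> j = 2 \<and> k = 4 \<or>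
      i = 1 \<and> j = 3 \<and> k = 4 \<or> i = 2 \<and> j = 3 \<and> k = 4" for i j k :: nat
    by presburger
  then show ?thesis by auto
qed

lemma opposite_faces:
  "{(l, i, j, k). l \<in> {1..4} \<and> {1..4} - {l} = {i, j, k} \<and> i < j \<and> j < k}
    = {(1, 2, 3, 4), (2, 1, 3, 4), (3, 1, 2, 4), (4, 1, 2, 3::nat)}" (is "?L = ?R")
proof
  show "?L \<subseteq> ?R"
  proof
    fix q assume "q \<in> ?L"
    then obtain l i j k where q: "q = (l, i, j, k)" "l \<in> {1..4}" "{1..4} - {l} = {i, j, k}"
      "i < j" "j < k"
      by auto
    from q(3) have "i \<in> {1..4} - {l}" "j \<in> {1..4} - {l}" "k \<in> {1..4} - {l}" by auto
    with q(2,4,5) have "l = 1 \<and> i = 2 \<and> j = 3 \<and> k = 4 \<or> l = 2 \<and> i = 1 \<and> j = 3 \<and> k = 4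
        \<or> l = 3 \<and> i = 1 \<and> j = 2 \<and> k = 4 \<or> l = 4 \<and> i = 1 \<and> j = 2 \<and> k = 3"
      unfolding atLeastAtMost_iff Diff_iff singleton_iff by presburger
    with q(1) show "q \<in> ?R" by auto
  qed
qed auto

section \<open>Determinant and volume as polynomials in the tangent lengths\<close>

text \<open>Polarization for two edge vectors with possibly four different endpoints; it expresses
  all inner products needed below by edge lengths.\<close>

lemma inner_diff_dist:
  fixes a b c d :: "'a :: real_inner"
  shows "inner (b - a) (d - c) = ((dist a d)\<^sup>2 + (dist b c)\<^sup>2 - (dist a c)\<^sup>2 - (dist b d)\<^sup>2) / 2"
  by (simp add: dist_norm power2_norm_eq_inner algebra_simps inner_commute)

lemma atiyah_D4_tangential:
  fixes t :: "nat \<Rightarrow> real"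
  assumes inj: "inj_on x {1..4}" and adm: "admissible_choice x \<alpha> \<beta>"
    and len: "\<And>i j. i \<in> {1..4} \<Longrightarrow> j \<in> {1..4} \<Longrightarrow> i < j \<Longrightarrow> edge_len x i j = t i + t j"
  shows "atiyah_D4 x \<alpha> \<beta> = of_real (64 *
    ((t 1 + t 2) * (t 1 + t 3) * (t 1 + t 4) * (t 2 + t 3) * (t 2 + t 4) * (t 3 + t 4)
     + t 1 * t 2 * t 3 * t 4 * ((t 1)\<^sup>2 + (t 2)\<^sup>2 + (t 3)\<^sup>2 + (t 4)\<^sup>2
         + 6 * (t 1 * t 2 + t 1 * t 3 + t 1 * t 4 + t 2 * t 3 + t 2 * t 4 + t 3 * t 4))
     - ((t 2 * t 3 * t 4)\<^sup>2 + (t 1 * t 3 * t 4)\<^sup>2 + (t 1 * t 2 * t 4)\<^sup>2 + (t 1 * t 2 * t 3)\<^sup>2)))"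
    (is "_ = of_real (64 * ?E)")
proof -
  have ne: "x i \<noteq> x j" if "i \<in> {1..4}" "j \<in> {1..4}" "i < j" for i j
    using inj_onD[OF inj _ that(1,2)] that(3) by auto
  define a0 where "a0 = \<alpha> 1 2"
  define b0 where "b0 = \<beta> 1 2"
  define r0 where "r0 = edge_len x 1 2"
  \<comment> \<open>The extra factor \<open>r0\<close> clears the denominators of the rotated
    entries, making them polynomial in the tangent lengths.\<close>
  define R where "R = (\<lambda>i j. complex_of_real (r0 * edge_len x i j))"
  define \<alpha>' where "\<alpha>' = (\<lambda>i j. b0 * \<alpha> i j - a0 * \<beta> i j)"
  define \<beta>' where "\<beta>' = (\<lambda>i j. cnj a0 * \<alpha> i j + cnj b0 * \<beta> i j)"
  have r0: "r0 > 0" using ne[of 1 2] by (simp add: r0_def edge_len_def)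
  have unit: "(cmod a0)\<^sup>2 + (cmod b0)\<^sup>2 = 1"
    using adm by (auto simp: admissible_choice_def a0_def b0_def)
  have \<alpha>'12: "\<alpha>' 1 2 = 0" by (simp add: \<alpha>'_def a0_def b0_def)
  \<comment> \<open>The simplifier turns the index 1 into \<open>Suc 0\<close>, so the defining
    equations are supplied in that form too.\<close>
  have "\<beta>' 1 2 = of_real ((cmod a0)\<^sup>2 + (cmod b0)\<^sup>2)"
    by (simp add: \<beta>'_def a0_def[symmetric] b0_def[symmetric] a0_def[simplified, symmetric] b0_def[simplified, symmetric]
        complex_norm_square mult.commute del: of_real_power)
  then have \<beta>'12: "\<beta>' 1 2 = 1" by (simp add: unit)
  define p where "p = (\<lambda>i j. R i j * (\<alpha>' i j * cnj (\<alpha>' i j)))"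
  define q where "q = (\<lambda>i j. R i j * (\<beta>' i j * cnj (\<beta>' i j)))"
  define w where "w = (\<lambda>i j. R i j * (\<alpha>' i j * cnj (\<beta>' i j)))"
  define u where "u = (\<lambda>i j. R i j * (\<beta>' i j * cnj (\<alpha>' i j)))"
  define L where "L = (\<lambda>v::real^3. Complex (v $ 1) (v $ 2) * a0\<^sup>2 - 2 * of_real (v $ 3) * a0 * b0
      - Complex (v $ 1) (- v $ 2) * b0\<^sup>2)"
  \<comment> \<open>The off-diagonal entries are linear in the edge vector and vanish on \<open>x 2 - x 1\<close>.\<close>
  have L_diff: "L (v - v') = L v - L v'" for v v'
    by (simp add: L_def Complex_eq algebra_simps)
  have wL: "2 * of_real (edge_len x i j) * (\<alpha>' i j * cnj (\<beta>' i j)) = L (x j - x i)"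
    if "i \<in> {1..4}" "j \<in> {1..4}" "i < j" for i j
    unfolding \<alpha>'_def \<beta>'_def L_def
    by (rule rotated_products(1)[OF admissible_products[OF adm that ne[OF that]]])
  have w: "w i j = of_real (r0 / 2) * L (x j - x i)"
    if "i \<in> {1..4}" "j \<in> {1..4}" "i < j" for i j
    unfolding w_def R_def wL[OF that, symmetric] by simp
  have "L (x 2 - x 1) = 0" using wL[of 1 2] \<alpha>'12 by simp
  then have L12: "L (x 2) = L (x 1)" by (simp add: L_diff)
  have w_rel: "w 2 3 = w 1 3" "w 2 4 = w 1 4" "w 3 4 = w 1 4 - w 1 3"
    by (simp_all add: w L_diff L12[simplified] algebra_simps)
  have u: "u i j = cnj (w i j)" for i j
    by (simp add: u_def w_def R_def mult.commute)
  have u_rel: "u 2 3 = u 1 3" "u 2 4 = u 1 4" "u 3 4 = u 1 4 - u 1 3"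
    unfolding u w_rel by simp_all
  have wu: "w i j * u i j = p i j * q i j" for i j
    by (simp add: w_def u_def p_def q_def mult_ac)
  have pq: "p i j = of_real ((r0 * edge_len x i j - inner (x 2 - x 1) (x j - x i)) / 2)"
    "q i j = of_real ((r0 * edge_len x i j + inner (x 2 - x 1) (x j - x i)) / 2)"
    if "i \<in> {1..4}" "j \<in> {1..4}" "i < j" for i j
    using rotated_products(2)[OF admissible_products[OF adm that ne[OF that]],
        OF admissible_products[OF adm, of 1 2, folded a0_def b0_def r0_def]] ne[of 1 2]
    by (simp_all add: p_def q_def R_def \<alpha>'_def \<beta>'_def)
  have dists: "dist (x i) (x j) = t i + t j" "dist (x j) (x i) = t i + t j"
    if "i \<in> {1..4}" "j \<in> {1..4}" "i < j" for i j
    using len[OF that] by (simp_all add: edge_len_def dist_commute)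
  have inner: "inner (x 2 - x 1) (x 3 - x 1) = ((t 1 + t 2)\<^sup>2 + (t 1 + t 3)\<^sup>2 - (t 2 + t 3)\<^sup>2) / 2"
    "inner (x 2 - x 1) (x 4 - x 1) = ((t 1 + t 2)\<^sup>2 + (t 1 + t 4)\<^sup>2 - (t 2 + t 4)\<^sup>2) / 2"
    "inner (x 2 - x 1) (x 3 - x 2) = ((t 1 + t 3)\<^sup>2 - (t 1 + t 2)\<^sup>2 - (t 2 + t 3)\<^sup>2) / 2"
    "inner (x 2 - x 1) (x 4 - x 2) = ((t 1 + t 4)\<^sup>2 - (t 1 + t 2)\<^sup>2 - (t 2 + t 4)\<^sup>2) / 2"
    "inner (x 2 - x 1) (x 4 - x 3) = ((t 1 + t 4)\<^sup>2 + (t 2 + t 3)\<^sup>2 - (t 1 + t 3)\<^sup>2 - (t 2 + t 4)\<^sup>2) / 2"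
    unfolding inner_diff_dist by (simp_all add: dists)
  have pqI: "p i j = of_real P" "q i j = of_real Q"
    if "inner (x 2 - x 1) (x j - x i) = J" "i \<in> {1..4}" "j \<in> {1..4}" "i < j"
      "P = ((t 1 + t 2) * (t i + t j) - J) / 2" "Q = ((t 1 + t 2) * (t i + t j) + J) / 2" for i j J P Q
    unfolding pq[OF that(2-4)] that(1,5,6) using len[OF that(2-4)] len[of 1 2] by (simp_all add: r0_def)
  have pq13: "p 1 3 = of_real (t 2 * t 3)" "q 1 3 = of_real (t 1 * (t 1 + t 2 + t 3))"
    using pqI[OF inner(1), of "t 2 * t 3" "t 1 * (t 1 + t 2 + t 3)"] by (simp_all add: field_simps power2_eq_square)
  have pq14: "p 1 4 = of_real (t 2 * t 4)" "q 1 4 = of_real (t 1 * (t 1 + t 2 + t 4))"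
    using pqI[OF inner(2), of "t 2 * t 4" "t 1 * (t 1 + t 2 + t 4)"] by (simp_all add: field_simps power2_eq_square)
  have pq23: "p 2 3 = of_real (t 2 * (t 1 + t 2 + t 3))" "q 2 3 = of_real (t 1 * t 3)"
    using pqI[OF inner(3), of "t 2 * (t 1 + t 2 + t 3)" "t 1 * t 3"] by (simp_all add: field_simps power2_eq_square)
  have pq24: "p 2 4 = of_real (t 2 * (t 1 + t 2 + t 4))" "q 2 4 = of_real (t 1 * t 4)"
    using pqI[OF inner(4), of "t 2 * (t 1 + t 2 + t 4)" "t 1 * t 4"] by (simp_all add: field_simps power2_eq_square)
  have pq34: "p 3 4 = of_real (t 1 * t 3 + t 2 * t 4)" "q 3 4 = of_real (t 1 * t 4 + t 2 * t 3)"
    using pqI[OF inner(5), of "t 1 * t 3 + t 2 * t 4" "t 1 * t 4 + t 2 * t 3"] by (simp_all add: field_simps power2_eq_square)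
  have pq_values: "p 1 3 = of_real (t 2) * of_real (t 3)"
      "q 1 3 = of_real (t 1) * (of_real (t 1) + of_real (t 2) + of_real (t 3))"
    "p 1 4 = of_real (t 2) * of_real (t 4)"
      "q 1 4 = of_real (t 1) * (of_real (t 1) + of_real (t 2) + of_real (t 4))"
    "p 2 3 = of_real (t 2) * (of_real (t 1) + of_real (t 2) + of_real (t 3))"
      "q 2 3 = of_real (t 1) * of_real (t 3)"
    "p 2 4 = of_real (t 2) * (of_real (t 1) + of_real (t 2) + of_real (t 4))"
      "q 2 4 = of_real (t 1) * of_real (t 4)"
    "p 3 4 = of_real (t 1) * of_real (t 3) + of_real (t 2) * of_real (t 4)"
      "q 3 4 = of_real (t 1) * of_real (t 4) + of_real (t 2) * of_real (t 3)"
    unfolding pq13 pq14 pq23 pq24 pq34 by simp_all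
  have "R 1 3 * R 1 4 * R 2 3 * R 2 4 * R 3 4 *
      Determinant.det (mat 4 4 (\<lambda>(i, j). coeff (atiyah_poly \<alpha>' \<beta>' (i + 1)) j)) = diagonal_form p q w u"
    unfolding p_def q_def w_def u_def by (rule det_atiyah_diagonal[of \<alpha>' \<beta>', OF \<alpha>'12 \<beta>'12])
  also have "\<dots> = of_real (r0 ^ 4 * ?E)"
    using diagonal_form_tangential[of p "of_real (t 2)" "of_real (t 3)" q "of_real (t 1)" "of_real (t 4)" w u,
        OF pq_values w_rel u_rel wu wu wu] len[of 1 2]
    by (simp add: r0_def)
  also have "Determinant.det (mat 4 4 (\<lambda>(i, j). coeff (atiyah_poly \<alpha>' \<beta>' (i + 1)) j)) =
      Determinant.det (mat 4 4 (\<lambda>(i, j). coeff (atiyah_poly \<alpha> \<beta> (i + 1)) j))" (is "_ = ?D")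
    unfolding \<alpha>'_def \<beta>'_def by (rule det_atiyah_rotate[OF unit])
  finally have main: "R 1 3 * R 1 4 * R 2 3 * R 2 4 * R 3 4 * ?D = of_real (r0 ^ 4 * ?E)" .
  \<comment> \<open>The weights contain \<open>r0\<close> five times; one copy serves as the length
    of edge 12 in the definition, and four are cancelled at the end.\<close>
  have "of_real (r0 ^ 4) * atiyah_D4 x \<alpha> \<beta> = 64 * (R 1 3 * R 1 4 * R 2 3 * R 2 4 * R 3 4 * ?D)"
    unfolding atiyah_D4_def vertex_pairs R_def r0_def by (simp add: power4_eq_xxxx mult_ac)
  also have "\<dots> = of_real (r0 ^ 4) * of_real (64 * ?E)"
    unfolding main by (simp only: of_real_mult of_real_numeral mult_ac)
  finally have scaled: "of_real (r0 ^ 4) * atiyah_D4 x \<alpha> \<beta> = of_real (r0 ^ 4) * of_real (64 * ?E)" .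
  have "complex_of_real (r0 ^ 4) \<noteq> 0" using r0 by simp
  from mult_left_cancel[OF this, THEN iffD1, OF scaled] show ?thesis .
qed

lemma tetra_volume_tangential:
  fixes t :: "nat \<Rightarrow> real"
  assumes inj: "inj_on x {1..4}"
    and len: "\<And>i j. i \<in> {1..4} \<Longrightarrow> j \<in> {1..4} \<Longrightarrow> i < j \<Longrightarrow> edge_len x i j = t i + t j"
  shows "288 * (tetra_volume x)\<^sup>2 =
    64 * (t 1 * t 2 * t 3 * t 4) * (t 1 * t 2 + t 1 * t 3 + t 1 * t 4 + t 2 * t 3 + t 2 * t 4 + t 3 * t 4)
    - 32 * ((t 2 * t 3 * t 4)\<^sup>2 + (t 1 * t 3 * t 4)\<^sup>2 + (t 1 * t 2 * t 4)\<^sup>2 + (t 1 * t 2 * t 3)\<^sup>2)"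
proof -
  have dists: "dist (x i) (x j) = t i + t j" "dist (x j) (x i) = t i + t j"
    if "i \<in> {1..4}" "j \<in> {1..4}" "i < j" for i j
    using len[OF that] by (simp_all add: edge_len_def dist_commute)
  have inner: "inner (x 2 - x 1) (x 3 - x 1) = ((t 1 + t 2)\<^sup>2 + (t 1 + t 3)\<^sup>2 - (t 2 + t 3)\<^sup>2) / 2"
    "inner (x 2 - x 1) (x 4 - x 1) = ((t 1 + t 2)\<^sup>2 + (t 1 + t 4)\<^sup>2 - (t 2 + t 4)\<^sup>2) / 2"
    "inner (x 3 - x 1) (x 4 - x 1) = ((t 1 + t 3)\<^sup>2 + (t 1 + t 4)\<^sup>2 - (t 3 + t 4)\<^sup>2) / 2"
    "inner (x 2 - x 1) (x 2 - x 1) = (t 1 + t 2)\<^sup>2"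
    "inner (x 3 - x 1) (x 3 - x 1) = (t 1 + t 3)\<^sup>2"
    "inner (x 4 - x 1) (x 4 - x 1) = (t 1 + t 4)\<^sup>2"
    unfolding inner_diff_dist by (simp_all add: dists)
  \<comment> \<open>The factor 8 is 288/36 and also clears the halves. The identity is proved for
    six free edge lengths before tangent lengths are inserted.\<close>
  have gram: "8 * (d2\<^sup>2 * d3\<^sup>2 * d4\<^sup>2
      + 2 * ((d2\<^sup>2 + d3\<^sup>2 - e\<^sup>2) / 2) * ((d3\<^sup>2 + d4\<^sup>2 - f\<^sup>2) / 2) * ((d2\<^sup>2 + d4\<^sup>2 - g\<^sup>2) / 2)
      - d2\<^sup>2 * ((d3\<^sup>2 + d4\<^sup>2 - f\<^sup>2) / 2)\<^sup>2 - d3\<^sup>2 * ((d2\<^sup>2 + d4\<^sup>2 - g\<^sup>2) / 2)\<^sup>2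
      - d4\<^sup>2 * ((d2\<^sup>2 + d3\<^sup>2 - e\<^sup>2) / 2)\<^sup>2) =
     8 * (d2 * d3 * d4)\<^sup>2 + 2 * (d2\<^sup>2 + d3\<^sup>2 - e\<^sup>2) * (d3\<^sup>2 + d4\<^sup>2 - f\<^sup>2) * (d2\<^sup>2 + d4\<^sup>2 - g\<^sup>2)
      - 2 * (d2 * (d3\<^sup>2 + d4\<^sup>2 - f\<^sup>2))\<^sup>2 - 2 * (d3 * (d2\<^sup>2 + d4\<^sup>2 - g\<^sup>2))\<^sup>2
      - 2 * (d4 * (d2\<^sup>2 + d3\<^sup>2 - e\<^sup>2))\<^sup>2" for d2 d3 d4 e f g :: real
    by (simp add: power2_eq_square)
  have poly: "8 * ((a + b) * (a + c) * (a + d))\<^sup>2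
      + 2 * ((a + b)\<^sup>2 + (a + c)\<^sup>2 - (b + c)\<^sup>2) * ((a + c)\<^sup>2 + (a + d)\<^sup>2 - (c + d)\<^sup>2) * ((a + b)\<^sup>2 + (a + d)\<^sup>2 - (b + d)\<^sup>2)
      - 2 * ((a + b) * ((a + c)\<^sup>2 + (a + d)\<^sup>2 - (c + d)\<^sup>2))\<^sup>2
      - 2 * ((a + c) * ((a + b)\<^sup>2 + (a + d)\<^sup>2 - (b + d)\<^sup>2))\<^sup>2
      - 2 * ((a + d) * ((a + b)\<^sup>2 + (a + c)\<^sup>2 - (b + c)\<^sup>2))\<^sup>2
    - (64 * (a * b * c * d) * (a * b + a * c + a * d + b * c + b * d + c * d)
      - 32 * ((b * c * d)\<^sup>2 + (a * c * d)\<^sup>2 + (a * b * d)\<^sup>2 + (a * b * c)\<^sup>2)) = 0" for a b c d :: real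
    by (simp add: algebra_simps power2_eq_square)
  have "288 * (tetra_volume x)\<^sup>2 = 8 * (36 * (tetra_volume x)\<^sup>2)" by simp
  also have "\<dots> = 8 * ((t 1 + t 2)\<^sup>2 * (t 1 + t 3)\<^sup>2 * (t 1 + t 4)\<^sup>2
      + 2 * (((t 1 + t 2)\<^sup>2 + (t 1 + t 3)\<^sup>2 - (t 2 + t 3)\<^sup>2) / 2) * (((t 1 + t 3)\<^sup>2 + (t 1 + t 4)\<^sup>2 - (t 3 + t 4)\<^sup>2) / 2)
        * (((t 1 + t 2)\<^sup>2 + (t 1 + t 4)\<^sup>2 - (t 2 + t 4)\<^sup>2) / 2)
      - (t 1 + t 2)\<^sup>2 * (((t 1 + t 3)\<^sup>2 + (t 1 + t 4)\<^sup>2 - (t 3 + t 4)\<^sup>2) / 2)\<^sup>2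
      - (t 1 + t 3)\<^sup>2 * (((t 1 + t 2)\<^sup>2 + (t 1 + t 4)\<^sup>2 - (t 2 + t 4)\<^sup>2) / 2)\<^sup>2
      - (t 1 + t 4)\<^sup>2 * (((t 1 + t 2)\<^sup>2 + (t 1 + t 3)\<^sup>2 - (t 2 + t 3)\<^sup>2) / 2)\<^sup>2)"
    unfolding tetra_volume_gram[OF inj] inner ..
  also note gram
  finally show ?thesis using poly[of "t 1" "t 2" "t 3" "t 4"] by simp
qed

section \<open>Inequalities in the tangent lengths\<close>

text \<open>This is the strong four points inequality after the term 64 times the product of the
  edges has cancelled. The constant 34 is 8 (4 + 1/4), as \<open>d3\<close> of a face is 8 times the
  product of its tangent lengths.\<close>

lemma strong_four_points_polynomial:
  fixes a b c d :: real
  assumes "a \<ge> 0" "b \<ge> 0" "c \<ge> 0" "d \<ge> 0"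
  shows "64 * (a * b * c * d * (a\<^sup>2 + b\<^sup>2 + c\<^sup>2 + d\<^sup>2 + 6 * (a * b + a * c + a * d + b * c + b * d + c * d))
      - ((b * c * d)\<^sup>2 + (a * c * d)\<^sup>2 + (a * b * d)\<^sup>2 + (a * b * c)\<^sup>2))
    - (4 + 3/4) * (64 * (a * b * c * d) * (a * b + a * c + a * d + b * c + b * d + c * d)
      - 32 * ((b * c * d)\<^sup>2 + (a * c * d)\<^sup>2 + (a * b * d)\<^sup>2 + (a * b * c)\<^sup>2))
    \<ge> 34 * ((a + b) * (a + c) * (a + d) * (b * c * d) + (b + a) * (b + c) * (b + d) * (a * c * d)
      + (c + a) * (c + b) * (c + d) * (a * b * d) + (d + a) * (d + b) * (d + c) * (a * b * c))"
    (is "?l \<ge> ?r")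
proof -
  \<comment> \<open>The weights come from comparing coefficients: (bcd)^2 has -64 + 32 (4 + 3/4) -
    34 = 54 = 3 * 18, and a^3 bcd has 64 - 34 = 30 = 3 * 10.\<close>
  have "?l - ?r =
      18 * ((b * c * d - a * c * d)\<^sup>2 + (b * c * d - a * b * d)\<^sup>2 + (b * c * d - a * b * c)\<^sup>2
        + (a * c * d - a * b * d)\<^sup>2 + (a * c * d - a * b * c)\<^sup>2 + (a * b * d - a * b * c)\<^sup>2)
    + 10 * (a * b * c * d) * ((a - b)\<^sup>2 + (a - c)\<^sup>2 + (a - d)\<^sup>2 + (b - c)\<^sup>2 + (b - d)\<^sup>2 + (c - d)\<^sup>2)"
    by (simp add: algebra_simps power2_eq_square)
  also have "\<dots> \<ge> 0"
    using assms by (intro add_nonneg_nonneg mult_nonneg_nonneg) auto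
  finally show ?thesis by simp
qed

text \<open>AM-GM on two pairs reduces the claim to their means \<open>u\<close>, \<open>v\<close>.
  There uv is at most (u + v)/2, so (u + 8)(v + 8) is at most 64 + (8 + 1/2)(u + v), and 8 + 1/2 is
  twice 4 + 1/4.\<close>

lemma product_four_le_square:
  fixes a b c d :: real
  assumes "a \<in> {0..1}" "b \<in> {0..1}" "c \<in> {0..1}" "d \<in> {0..1}"
  shows "(a + 8) * (b + 8) * (c + 8) * (d + 8) \<le> (64 + (4 + 1/4) * (a + b + c + d))\<^sup>2"
proof -
  define u where "u = (a + b) / 2"
  define v where "v = (c + d) / 2"
  have uv: "u \<ge> 0" "v \<ge> 0" "u \<le> 1" "v \<le> 1" using assms by (auto simp: u_def v_def)
  have AM_GM: "(y + 8) * (z + 8) \<le> ((y + z) / 2 + 8)\<^sup>2" for y z :: real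
    using zero_le_power2[of "y - z"] by (simp add: power2_eq_square field_simps)
  have "u * v \<le> u" "u * v \<le> v"
    using uv mult_left_mono[of v 1 u] mult_right_mono[of u 1 v] by simp_all
  then have 1: "(u + 8) * (v + 8) \<le> 64 + (4 + 1/4) * (a + b + c + d)"
    by (simp add: u_def v_def field_simps)
  have "(a + 8) * (b + 8) * ((c + 8) * (d + 8)) \<le> (u + 8)\<^sup>2 * (v + 8)\<^sup>2"
    unfolding u_def v_def by (intro mult_mono AM_GM) (use assms in auto)
  also have "\<dots> = ((u + 8) * (v + 8))\<^sup>2" by (simp add: power_mult_distrib)
  also have "\<dots> \<le> (64 + (4 + 1/4) * (a + b + c + d))\<^sup>2"
    using 1 uv by (intro power_mono) auto
  finally show ?thesis by (simp add: mult.assoc)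
qed

lemma d3_tangential: "d3 (a + b) (a + c) (b + c) = 8 * (a * b * c)"
  by (simp add: d3_def algebra_simps)

lemma d3_tangential_le:
  fixes a b c :: real
  assumes "a \<ge> 0" "b \<ge> 0" "c \<ge> 0"
  shows "8 * (a * b * c) \<le> (a + b) * (a + c) * (b + c)"
proof -
  have "(a + b) * (a + c) * (b + c) - 8 * (a * b * c) = a * (b - c)\<^sup>2 + b * (a - c)\<^sup>2 + c * (a - b)\<^sup>2"
    by (simp add: algebra_simps power2_eq_square)
  also have "\<dots> \<ge> 0" using assms by simp
  finally show ?thesis by simp
qed

section \<open>Strong four points inequality and (C3)\<close>

theorem mainTheorem4:
  fixes x :: "nat \<Rightarrow> real^3" and \<alpha> \<beta> :: "nat \<Rightarrow> nat \<Rightarrow> complex"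
  assumes "inj_on x {1..4}"
    and "edge_tangential x"
    and "admissible_choice x \<alpha> \<beta>"
  shows "(cmod (atiyah_D4 x \<alpha> \<beta>))\<^sup>2 \<ge>
      (\<Prod>(i, j, k) \<in> {(i, j, k). 1 \<le> i \<and> i < j \<and> j < k \<and> k \<le> 4}.
         d3 (edge_len x i j) (edge_len x i k) (edge_len x j k)
           + 8 * edge_len x i j * edge_len x i k * edge_len x j k)
    \<and> Re (atiyah_D4 x \<alpha> \<beta>) - (4 + 3/4) * (288 * (tetra_volume x)\<^sup>2) \<ge>
      64 * (\<Prod>(i, j) \<in> {(i, j). 1 \<le> i \<and> i < j \<and> j \<le> 4}. edge_len x i j)
      + (\<Sum>(l, i, j, k) \<in> {(l, i, j, k). l \<in> {1..4} \<and> {1..4} - {l} = {i, j, k} \<and> i < j \<and> j < k}.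
           (4 + 1/4) * (edge_len x i l * edge_len x j l * edge_len x k l)
             * d3 (edge_len x i j) (edge_len x i k) (edge_len x j k))"
proof -
  from edge_tangential_lengths[OF assms(2)] obtain t :: "nat \<Rightarrow> real" where
    t0: "\<And>i. i \<in> {1..4} \<Longrightarrow> t i \<ge> 0" and
    t: "\<And>i j. i \<in> {1..4} \<Longrightarrow> j \<in> {1..4} \<Longrightarrow> i < j \<Longrightarrow> edge_len x i j = t i + t j"
    by blast
  define a b c d where "a = t 1" and "b = t 2" and "c = t 3" and "d = t 4"
  note abcd = a_def[symmetric] b_def[symmetric] c_def[symmetric] d_def[symmetric]
  have nonneg: "a \<ge> 0" "b \<ge> 0" "c \<ge> 0" "d \<ge> 0"
    using t0[of 1] t0[of 2] t0[of 3] t0[of 4] by (simp_all add: a_def b_def c_def d_def)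
  have len: "edge_len x 1 2 = a + b" "edge_len x 1 3 = a + c" "edge_len x 1 4 = a + d"
    "edge_len x 2 3 = b + c" "edge_len x 2 4 = b + d" "edge_len x 3 4 = c + d"
    "edge_len x 2 1 = a + b" "edge_len x 3 1 = a + c" "edge_len x 4 1 = a + d"
    "edge_len x 3 2 = b + c" "edge_len x 4 2 = b + d" "edge_len x 4 3 = c + d"
    using t[of 1 2] t[of 1 3] t[of 1 4] t[of 2 3] t[of 2 4] t[of 3 4]
    by (simp_all add: edge_len_def dist_commute a_def b_def c_def d_def)
  \<comment> \<open>The tangent lengths are only known to be nonnegative; distinct vertices make the
    pairwise sums positive, as the quotients \<open>\<delta>\<close> require.\<close>
  have "edge_len x i j > 0" if "i \<in> {1..4}" "j \<in> {1..4}" "i < j" for i j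
    using inj_onD[OF assms(1) _ that(1,2)] that(3) by (auto simp: edge_len_def)
  from this[of 1 2] this[of 1 3] this[of 1 4] this[of 2 3] this[of 2 4] this[of 3 4]
  have pos: "a + b > 0" "a + c > 0" "a + d > 0" "b + c > 0" "b + d > 0" "c + d > 0"
    unfolding len by simp_all
  define E where "E = (a + b) * (a + c) * (a + d) * (b + c) * (b + d) * (c + d)"
  define S where "S = (a + b) * (a + c) * (a + d) * (b * c * d) + (b + a) * (b + c) * (b + d) * (a * c * d)
      + (c + a) * (c + b) * (c + d) * (a * b * d) + (d + a) * (d + b) * (d + c) * (a * b * c)"
  define D where "D = 64 * (E
     + a * b * c * d * (a\<^sup>2 + b\<^sup>2 + c\<^sup>2 + d\<^sup>2 + 6 * (a * b + a * c + a * d + b * c + b * d + c * d))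
     - ((b * c * d)\<^sup>2 + (a * c * d)\<^sup>2 + (a * b * d)\<^sup>2 + (a * b * c)\<^sup>2))"
  have D4: "atiyah_D4 x \<alpha> \<beta> = of_real D"
    using atiyah_D4_tangential[OF assms(1,3) t] unfolding abcd D_def E_def .
  have vol: "288 * (tetra_volume x)\<^sup>2 =
      64 * (a * b * c * d) * (a * b + a * c + a * d + b * c + b * d + c * d)
      - 32 * ((b * c * d)\<^sup>2 + (a * c * d)\<^sup>2 + (a * b * d)\<^sup>2 + (a * b * c)\<^sup>2)"
    using tetra_volume_tangential[OF assms(1) t] unfolding abcd .
  have four_points: "D - (4 + 3/4) * (288 * (tetra_volume x)\<^sup>2) \<ge> 64 * E + 34 * S"
    using strong_four_points_polynomial[OF nonneg] unfolding vol D_def S_def by simp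
  have edges: "(\<Prod>(i, j) \<in> {(i, j). 1 \<le> i \<and> i < j \<and> j \<le> 4}. edge_len x i j) = E"
    unfolding vertex_pairs by (simp add: len[simplified] E_def mult_ac)
  have faces: "(\<Sum>(l, i, j, k) \<in> {(l, i, j, k). l \<in> {1..4} \<and> {1..4} - {l} = {i, j, k} \<and> i < j \<and> j < k}.
           (4 + 1/4) * (edge_len x i l * edge_len x j l * edge_len x k l)
             * d3 (edge_len x i j) (edge_len x i k) (edge_len x j k)) = 34 * S"
    unfolding opposite_faces by (simp add: len[simplified] d3_tangential S_def field_simps)
  define \<delta> where "\<delta> = (\<lambda>a b c. 8 * (a * b * c) / ((a + b) * (a + c) * (b + c) :: real))"
  have \<delta>: "\<delta> p q r \<in> {0..1}" "8 * (p * q * r) + 8 * ((p + q) * (p + r) * (q + r))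
      = (p + q) * (p + r) * (q + r) * (\<delta> p q r + 8)"
    if "p \<ge> 0" "q \<ge> 0" "r \<ge> 0" "p + q > 0" "p + r > 0" "q + r > 0" for p q r
  proof -
    define N where "N = (p + q) * (p + r) * (q + r)"
    define m where "m = p * q * r"
    have N: "N > 0" "m \<ge> 0" "8 * m \<le> N"
      using that d3_tangential_le[of p q r] by (simp_all add: N_def m_def)
    have "\<delta> p q r = 8 * m / N" by (simp add: N_def m_def \<delta>_def)
    with N show "\<delta> p q r \<in> {0..1}" "8 * (p * q * r) + 8 * ((p + q) * (p + r) * (q + r))
        = (p + q) * (p + r) * (q + r) * (\<delta> p q r + 8)"
      unfolding N_def[symmetric] m_def[symmetric] by (simp_all add: divide_le_eq distrib_left)
  qed
  note \<delta>s = \<delta>[OF nonneg(1,2,3) pos(1,2,4)] \<delta>[OF nonneg(1,2,4) pos(1,3,5)]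
    \<delta>[OF nonneg(1,3,4) pos(2,3,6)] \<delta>[OF nonneg(2,3,4) pos(4,5,6)]
  \<comment> \<open>The edges of a face cancel against the denominator, leaving the three edges at
    the opposite vertex.\<close>
  have E\<delta>: "E * \<delta> a b c = 8 * ((d + a) * (d + b) * (d + c) * (a * b * c))"
    "E * \<delta> a b d = 8 * ((c + a) * (c + b) * (c + d) * (a * b * d))"
    "E * \<delta> a c d = 8 * ((b + a) * (b + c) * (b + d) * (a * c * d))"
    "E * \<delta> b c d = 8 * ((a + b) * (a + c) * (a + d) * (b * c * d))"
    using pos
    by (simp_all add: \<delta>_def E_def nonzero_eq_divide_eq nonzero_divide_eq_eq add.commute mult_ac)
      (simp_all add: algebra_simps)
  have E0: "E \<ge> 0" unfolding E_def using pos by simp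
  have "(\<Prod>(i, j, k) \<in> {(i, j, k). 1 \<le> i \<and> i < j \<and> j < k \<and> k \<le> 4}.
         d3 (edge_len x i j) (edge_len x i k) (edge_len x j k)
           + 8 * edge_len x i j * edge_len x i k * edge_len x j k) =
      (8 * (a * b * c) + 8 * ((a + b) * (a + c) * (b + c))) * (8 * (a * b * d) + 8 * ((a + b) * (a + d) * (b + d)))
      * (8 * (a * c * d) + 8 * ((a + c) * (a + d) * (c + d))) * (8 * (b * c * d) + 8 * ((b + c) * (b + d) * (c + d)))"
    unfolding vertex_triples by (simp add: len[simplified] d3_tangential mult.assoc)
  \<comment> \<open>Every edge lies in two faces, so the four face products multiply to
    \<open>E\<^sup>2\<close>.\<close>
  also have "\<dots> = E\<^sup>2 * ((\<delta> a b c + 8) * (\<delta> a b d + 8) * (\<delta> a c d + 8) * (\<delta> b c d + 8))"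
    unfolding \<delta>s by (simp add: E_def power2_eq_square mult_ac)
  also have "\<dots> \<le> E\<^sup>2 * (64 + (4 + 1/4) * (\<delta> a b c + \<delta> a b d + \<delta> a c d + \<delta> b c d))\<^sup>2"
    by (intro mult_left_mono product_four_le_square \<delta>s) simp
  also have "\<dots> = (64 * E + (4 + 1/4) * (E * \<delta> a b c + E * \<delta> a b d + E * \<delta> a c d + E * \<delta> b c d))\<^sup>2"
    by (simp add: power_mult_distrib[symmetric] algebra_simps add_divide_distrib)
  also have "\<dots> = (64 * E + 34 * S)\<^sup>2"
    unfolding E\<delta> by (rule arg_cong[of _ _ "\<lambda>z. z\<^sup>2"]) (simp add: S_def field_simps)
  also have "\<dots> \<le> D\<^sup>2"
  proof (rule power_mono)
    show "64 * E + 34 * S \<le> D"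
      by (rule order_trans[OF four_points]) simp
    show "0 \<le> 64 * E + 34 * S" unfolding S_def using E0 nonneg by simp
  qed
  also have "\<dots> = (cmod (atiyah_D4 x \<alpha> \<beta>))\<^sup>2" unfolding D4 by simp
  finally show ?thesis using four_points unfolding edges faces D4 by simp
qed

end
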